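(* Suppose that $F=f+g$ is bounded from below, that the sublevel set $\Omega_{x_0}=\{x\in\mathcal{M} : F(x)\le F(x_0)\}$ is compact, and that $f$ is $L$-retraction-smooth with respect to the retraction $R$ in $\Omega_{x_0}$. Let $\{x_k\}$ and $\{\hat\eta_{x_k}\}$ be generated by the inexact Riemannian proximal gradient method (IRPG, see context) with initial iterate $x_0$, parameter $\tilde L> L$, and accuracy function $q$ such that $\lim_{k\to\infty} q(\varepsilon_k,\|\hat\eta_{x_k}\|)=0$. Let $\beta=(\tilde L-L)/2$. Then the sequence $\{x_k\}$ has at least one accumulation point. Let $x_*$ be any accumulation point of $\{x_k\}$. Then $x_*$ is a stationary point of $F$. Furthermore, for every $\epsilon>0$, the method returns an $x_k$ satisfying $\|\hat\eta_{x_k}\|\le\epsilon$ in at most $(F(x_0)-F(x_* ))/(\beta\epsilon^2)$ iterations.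
   Context: $\mathcal{M}$ is a finite dimensional Riemannian manifold with metric $\langle\cdot,\cdot\rangle_x$ and induced norm $\|\cdot\|$ on $\mathrm{T}_x\mathcal{M}$. The problem is $\min_{x\in\mathcal{M}}F(x)=f(x)+g(x)$, where $f:\mathcal{M}\to\mathbb{R}$ is differentiable and $g:\mathcal{M}\to\mathbb{R}$ is continuous but possibly nonsmooth; $\mathrm{grad} f$ is the Riemannian gradient. Retraction: a smooth map $R:\mathrm{T}\mathcal{M}\to\mathcal{M}$, assumed defined on the whole tangent bundle, with restriction $R_x$ to $\mathrm{T}_x\mathcal{M}$, such that $R_x(0_x)=x$ and $\frac{d}{dt}R_x(t\eta_x)|_{t=0}=\eta_x$ for all $\eta_x\in \mathrm{T}_x\mathcal{M}$. $L$-retraction-smooth: $h:\mathcal{M}\to\mathbb{R}$ is $L$-retraction-smooth with respect to $R$ in $\mathcal{N}\subseteq\mathcal{M}$ if for any $x\in\mathcal{N}$ and any $\mathcal{S}_x\subseteq \mathrm{T}_x\mathcal{M}$ with $R_x(\mathcal{S}_x)\subseteq\mathcal{N}$, one has $h(R_x(\eta))\le h(x)+\langle \mathrm{grad}\, h(x),\eta\rangle_x+\frac L2\|\eta\|^2$ for all $\eta\in\mathcal{S}_x$. Subdifferential and stationarity: for a Lipschitz continuous function $h$ on $\mathcal{M}$, put $\hat h_x=h\circ R_x$ on the Hilbert space $\mathrm{T}_x\mathcal{M}$; $\partial\hat h_x(\eta)$ is its Clarke generalized subdifferential at $\eta$, and the Riemannian generalized subdifferential of $h$ at $x$ is $\partial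 h(x)=\partial\hat h_x(0_x)$. A point $x$ is a stationary point of $F$ if $0\in\partial F(x)$. A stationary point of a function $\ell$ on $\mathrm{T}_x\mathcal{M}$ is an $\eta$ with $0\in\partial\ell(\eta)$. IRPG: given $x_0\in\mathcal{M}$ and $\tilde L>0$, for $k=0,1,2,\dots$ let $$\ell_{x_k}(\eta)=\langle\mathrm{grad} f(x_k),\eta\rangle_{x_k}+\tfrac{\tilde L}{2}\|\eta\|^2+g(R_{x_k}(\eta)),\qquad \eta\in \mathrm{T}_{x_k}\mathcal{M};$$ find $\hat\eta_{x_k}\in \mathrm{T}_{x_k}\mathcal{M}$ such that $\|\hat\eta_{x_k}-\eta_{x_k}^*\|\le q(\varepsilon_k,\|\hat\eta_{x_k}\|)$ and $\ell_{x_k}(0)\ge\ell_{x_k}(\hat\eta_{x_k})$, where $\eta^*_{x_k}$ is a stationary point of $\ell_{x_k}$, $\varepsilon_k>0$, and $q:\mathbb{R}^2\to\mathbb{R}$ is a continuous function; set $x_{k+1}=R_{x_k}(\hat\eta_{x_k})$.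
   Formalization: The formal theorem additionally assumes that all iterates x_k lie in the sublevel set Ω_{x_0}, that grad f is continuous at x_0, and that g is locally Lipschitz (so the subdifferentials are defined); without the first two the statement has counterexamples. *)

theory Defs
  imports "HOL-Analysis.Analysis"
begin

section \<open>Smooth maps between open subsets of Euclidean spaces\<close>

text \<open>Only used for open sets in finite dimensional spaces, where it suffices to ask for the
  directional derivatives to be of class C^k.\<close>

fun Ck_on :: "nat \<Rightarrow> ('a::euclidean_space \<Rightarrow> 'b::euclidean_space) \<Rightarrow> 'a set \<Rightarrow> bool" where
  "Ck_on 0 f S \<longleftrightarrow> continuous_on S f"
| "Ck_on (Suc k) f S \<longleftrightarrow>
     (\<forall>x\<in>S. f differentiable (at x)) \<and> (\<forall>v. Ck_on k (\<lambda>x. frechet_derivative f (at x) v) S)"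

definition smooth_on :: "('a::euclidean_space \<Rightarrow> 'b::euclidean_space) \<Rightarrow> 'a set \<Rightarrow> bool" where
  "smooth_on f S \<longleftrightarrow> (\<forall>k. Ck_on k f S)"


section \<open>Smooth manifolds and their tangent spaces\<close>

text \<open>A chart is a pair of its domain and its coordinate map into the model space \<open>'e\<close>; the
  values of the coordinate map outside the domain are irrelevant.\<close>

type_synonym ('m, 'e) chart = "'m set \<times> ('m \<Rightarrow> 'e)"

definition chart_inv :: "('m, 'e) chart \<Rightarrow> 'e \<Rightarrow> 'm" where
  "chart_inv c = inv_into (fst c) (snd c)"

definition chart_image :: "('m, 'e) chart \<Rightarrow> 'e set" where
  "chart_image c = snd c ` fst c"

definition smooth_atlas ::
  "('m::{t2_space, second_countable_topology}, 'e::euclidean_space) chart set \<Rightarrow> bool" where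
  "smooth_atlas A \<longleftrightarrow>
     (\<Union>c\<in>A. fst c) = UNIV \<and>
     (\<forall>c\<in>A. open (fst c) \<and> open (chart_image c) \<and>
        homeomorphism (fst c) (chart_image c) (snd c) (chart_inv c)) \<and>
     (\<forall>c\<in>A. \<forall>d\<in>A. smooth_on (snd d \<circ> chart_inv c) (snd c ` (fst c \<inter> fst d)))"

text \<open>The tangent space at \<open>x\<close> is the model space \<open>'e\<close> itself, a vector being identified with its
  coordinates in one chart \<open>chart_at A x\<close> around \<open>x\<close> that is chosen once and for all. The tangent
  bundle is \<open>'m \<times> 'e\<close> as a set; its smooth structure is not the product one: the bundle chart
  induced by a chart \<open>c\<close> is the inverse of the map sending \<open>(p, u)\<close> to the point \<open>chart_inv c p\<close>
  together with the vector \<open>tangent_vec A c p u\<close> at that point, whose coordinates in \<open>c\<close> are \<open>u\<close>.\<close>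

definition chart_at :: "('m, 'e) chart set \<Rightarrow> 'm \<Rightarrow> ('m, 'e) chart" where
  "chart_at A x = (SOME c. c \<in> A \<and> x \<in> fst c)"

definition tangent_vec ::
  "('m, 'e::euclidean_space) chart set \<Rightarrow> ('m, 'e) chart \<Rightarrow> 'e \<Rightarrow> 'e \<Rightarrow> 'e" where
  "tangent_vec A c p u =
     frechet_derivative (snd (chart_at A (chart_inv c p)) \<circ> chart_inv c) (at p) u"

definition riemannian_metric ::
  "('m, 'e::euclidean_space) chart set \<Rightarrow> ('m \<Rightarrow> 'e \<Rightarrow> 'e \<Rightarrow> real) \<Rightarrow> bool" where
  "riemannian_metric A G \<longleftrightarrow>
     (\<forall>x. bilinear (G x) \<and> (\<forall>u v. G x u v = G x v u) \<and> (\<forall>u. u \<noteq> 0 \<longrightarrow> 0 < G x u u)) \<and>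
     (\<forall>c\<in>A. \<forall>u v. smooth_on
        (\<lambda>p. G (chart_inv c p) (tangent_vec A c p u) (tangent_vec A c p v)) (chart_image c))"

definition riemannian_manifold ::
  "('m::{t2_space, second_countable_topology}, 'e::euclidean_space) chart set \<Rightarrow>
   ('m \<Rightarrow> 'e \<Rightarrow> 'e \<Rightarrow> real) \<Rightarrow> bool" where
  "riemannian_manifold A G \<longleftrightarrow> smooth_atlas A \<and> riemannian_metric A G"

definition rnorm :: "('m \<Rightarrow> 'e \<Rightarrow> 'e \<Rightarrow> real) \<Rightarrow> 'm \<Rightarrow> 'e \<Rightarrow> real" where
  "rnorm G x u = sqrt (G x u u)"


section \<open>Functions on a manifold\<close>

definition differentiable_on_manifold ::
  "('m, 'e::euclidean_space) chart set \<Rightarrow> ('m \<Rightarrow> real) \<Rightarrow> bool" where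
  "differentiable_on_manifold A f \<longleftrightarrow>
     (\<forall>c\<in>A. \<forall>p\<in>chart_image c. (f \<circ> chart_inv c) differentiable (at p))"

definition grad ::
  "('m, 'e::euclidean_space) chart set \<Rightarrow> ('m \<Rightarrow> 'e \<Rightarrow> 'e \<Rightarrow> real) \<Rightarrow> ('m \<Rightarrow> real) \<Rightarrow> 'm \<Rightarrow> 'e" where
  "grad A G f x = (THE w. \<forall>u. G x w u =
     frechet_derivative (f \<circ> chart_inv (chart_at A x)) (at (snd (chart_at A x) x)) u)"

text \<open>Continuity at \<open>x\<close> of the derivative in charts, hence of the vector field \<open>grad A G f\<close>.\<close>

definition grad_continuous_at ::
  "('m, 'e::euclidean_space) chart set \<Rightarrow> ('m \<Rightarrow> real) \<Rightarrow> 'm \<Rightarrow> bool" where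
  "grad_continuous_at A f x \<longleftrightarrow> (\<forall>c\<in>A. x \<in> fst c \<longrightarrow>
     (\<forall>v. isCont (\<lambda>p. frechet_derivative (f \<circ> chart_inv c) (at p) v) (snd c x)))"

text \<open>Local Lipschitz continuity in charts. It is the same as local Lipschitz continuity for the
  Riemannian distance, which is locally equivalent to the Euclidean distance in a chart.\<close>

definition locally_lipschitz ::
  "('m, 'e::euclidean_space) chart set \<Rightarrow> ('m \<Rightarrow> real) \<Rightarrow> bool" where
  "locally_lipschitz A h \<longleftrightarrow> (\<forall>c\<in>A. \<forall>p\<in>chart_image c. \<exists>r>0. \<exists>K.
     K-lipschitz_on (ball p r \<inter> chart_image c) (h \<circ> chart_inv c))"


section \<open>Retractions\<close>

text \<open>Smoothness of \<open>R\<close> as a map on the tangent bundle: \<open>retraction_dom A R c d\<close> is the set of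
  pairs \<open>(p, u)\<close>, in the bundle chart induced by \<open>c\<close>, that \<open>R\<close> sends into the domain of \<open>d\<close>. That
  all these sets are open, together with the smoothness of the coordinate representations, contains
  the continuity of \<open>R\<close>.\<close>

definition retraction_dom ::
  "('m, 'e::euclidean_space) chart set \<Rightarrow> ('m \<Rightarrow> 'e \<Rightarrow> 'm) \<Rightarrow>
   ('m, 'e) chart \<Rightarrow> ('m, 'e) chart \<Rightarrow> ('e \<times> 'e) set" where
  "retraction_dom A R c d =
     {(p, u). p \<in> chart_image c \<and> R (chart_inv c p) (tangent_vec A c p u) \<in> fst d}"

definition smooth_bundle_map ::
  "('m, 'e::euclidean_space) chart set \<Rightarrow> ('m \<Rightarrow> 'e \<Rightarrow> 'm) \<Rightarrow> bool" where
  "smooth_bundle_map A R \<longleftrightarrow> (\<forall>c\<in>A. \<forall>d\<in>A.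
     open (retraction_dom A R c d) \<and>
     smooth_on (\<lambda>(p, u). snd d (R (chart_inv c p) (tangent_vec A c p u)))
       (retraction_dom A R c d))"

definition manifold_retraction ::
  "('m, 'e::euclidean_space) chart set \<Rightarrow> ('m \<Rightarrow> 'e \<Rightarrow> 'm) \<Rightarrow> bool" where
  "manifold_retraction A R \<longleftrightarrow>
     smooth_bundle_map A R \<and>
     (\<forall>x. R x 0 = x) \<and>
     (\<forall>x u. ((\<lambda>t. snd (chart_at A x) (R x (t *\<^sub>R u))) has_vector_derivative u) (at 0))"

definition retraction_smooth ::
  "('m, 'e::euclidean_space) chart set \<Rightarrow> ('m \<Rightarrow> 'e \<Rightarrow> 'e \<Rightarrow> real) \<Rightarrow> ('m \<Rightarrow> 'e \<Rightarrow> 'm) \<Rightarrow>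
   real \<Rightarrow> ('m \<Rightarrow> real) \<Rightarrow> 'm set \<Rightarrow> bool" where
  "retraction_smooth A G R L h N \<longleftrightarrow>
     (\<forall>x\<in>N. \<forall>S. R x ` S \<subseteq> N \<longrightarrow>
        (\<forall>u\<in>S. h (R x u) \<le> h x + G x (grad A G h x) u + L / 2 * (rnorm G x u)\<^sup>2))"


section \<open>Clarke subdifferential and stationary points\<close>

definition clarke_dd :: "('e::euclidean_space \<Rightarrow> real) \<Rightarrow> 'e \<Rightarrow> 'e \<Rightarrow> ereal" where
  "clarke_dd l u v =
     Limsup (nhds u \<times>\<^sub>F at_right 0) (\<lambda>(y, t). ereal ((l (y + t *\<^sub>R v) - l y) / t))"

text \<open>Subgradients are represented through the inner product \<open>B\<close>. The limit superior above is taken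
  in the topology of \<open>'e\<close>, which is also that of the norm of \<open>B\<close>.\<close>

definition clarke_subdiff ::
  "('e \<Rightarrow> 'e \<Rightarrow> real) \<Rightarrow> ('e::euclidean_space \<Rightarrow> real) \<Rightarrow> 'e \<Rightarrow> 'e set" where
  "clarke_subdiff B l u = {w. \<forall>v. ereal (B w v) \<le> clarke_dd l u v}"

definition riem_subdiff ::
  "('m \<Rightarrow> 'e \<Rightarrow> 'e \<Rightarrow> real) \<Rightarrow> ('m \<Rightarrow> 'e \<Rightarrow> 'm) \<Rightarrow> ('m \<Rightarrow> real) \<Rightarrow> 'm \<Rightarrow> ('e::euclidean_space) set"
  where "riem_subdiff G R h x = clarke_subdiff (G x) (h \<circ> R x) 0"

definition stationary_point ::
  "('m \<Rightarrow> 'e \<Rightarrow> 'e \<Rightarrow> real) \<Rightarrow> ('m \<Rightarrow> ('e::euclidean_space) \<Rightarrow> 'm) \<Rightarrow> ('m \<Rightarrow> real) \<Rightarrow> 'm \<Rightarrow> bool"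
  where "stationary_point G R h x \<longleftrightarrow> 0 \<in> riem_subdiff G R h x"

definition tangent_stationary_point ::
  "('m \<Rightarrow> 'e \<Rightarrow> 'e \<Rightarrow> real) \<Rightarrow> 'm \<Rightarrow> (('e::euclidean_space) \<Rightarrow> real) \<Rightarrow> 'e \<Rightarrow> bool"
  where "tangent_stationary_point G x l u \<longleftrightarrow> 0 \<in> clarke_subdiff (G x) l u"


section \<open>The inexact Riemannian proximal gradient method\<close>

definition prox_model ::
  "('m, 'e::euclidean_space) chart set \<Rightarrow> ('m \<Rightarrow> 'e \<Rightarrow> 'e \<Rightarrow> real) \<Rightarrow> ('m \<Rightarrow> 'e \<Rightarrow> 'm) \<Rightarrow>
   ('m \<Rightarrow> real) \<Rightarrow> ('m \<Rightarrow> real) \<Rightarrow> real \<Rightarrow> 'm \<Rightarrow> 'e \<Rightarrow> real" where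
  "prox_model A G R f g Lt x u =
     G x (grad A G f x) u + Lt / 2 * (rnorm G x u)\<^sup>2 + g (R x u)"

definition irpg_sequence ::
  "('m, 'e::euclidean_space) chart set \<Rightarrow> ('m \<Rightarrow> 'e \<Rightarrow> 'e \<Rightarrow> real) \<Rightarrow> ('m \<Rightarrow> 'e \<Rightarrow> 'm) \<Rightarrow>
   ('m \<Rightarrow> real) \<Rightarrow> ('m \<Rightarrow> real) \<Rightarrow> real \<Rightarrow> (real \<Rightarrow> real \<Rightarrow> real) \<Rightarrow> (nat \<Rightarrow> real) \<Rightarrow>
   'm \<Rightarrow> (nat \<Rightarrow> 'm) \<Rightarrow> (nat \<Rightarrow> 'e) \<Rightarrow> bool" where
  "irpg_sequence A G R f g Lt q eps x0 xs eta \<longleftrightarrow>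
     xs 0 = x0 \<and>
     (\<forall>k. 0 < eps k \<and>
        (\<exists>eta_star.
           tangent_stationary_point G (xs k) (prox_model A G R f g Lt (xs k)) eta_star \<and>
           rnorm G (xs k) (eta k - eta_star) \<le> q (eps k) (rnorm G (xs k) (eta k))) \<and>
        prox_model A G R f g Lt (xs k) (eta k) \<le> prox_model A G R f g Lt (xs k) 0 \<and>
        xs (Suc k) = R (xs k) (eta k))"

definition accumulation_point :: "(nat \<Rightarrow> 'm::topological_space) \<Rightarrow> 'm \<Rightarrow> bool" where
  "accumulation_point xs x \<longleftrightarrow> (\<exists>r. strict_mono r \<and> (xs \<circ> r) \<longlonglongrightarrow> x)"

end

theory Submission
  imports Defs
begin

text \<open>
  Comparing the proximal model at \<open>eta k\<close> and at \<open>0\<close> and using retraction-smoothness with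
  \<open>L < Lt\<close> gives \<open>F (x\<^sub>k\<^sub>+\<^sub>1) + \<beta> \<parallel>eta k\<parallel>\<^sup>2 \<le> F (x\<^sub>k)\<close>
  (\<open>irpg_sufficient_decrease\<close>). Telescoping bounds the number of steps with \<open>\<parallel>eta k\<parallel> > \<epsilon>\<close> and
  forces \<open>\<parallel>eta k\<parallel>\<close> to \<open>0\<close>; since \<open>q\<close> tends to \<open>0\<close>, the exact stationary points near the
  \<open>eta k\<close> tend to \<open>0\<close> as well. Compactness of the sublevel set yields accumulation points.

  Stationarity of an accumulation point \<open>x\<close> is then a closedness property
  (\<open>stationary_point_limit\<close>): stationary points of the models at \<open>x\<^sub>k\<close> that tend to \<open>0\<close> make
  \<open>x\<close> stationary. The models live on different tangent spaces, so everything is read in one chart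
  around \<open>x\<close>, where the retraction becomes a map \<open>\<Phi> (p, u)\<close> of the base point and the tangent
  vector. A nonnegative Clarke derivative means that difference quotients with base point and step
  arbitrarily close to the limit are almost nonnegative. Such a quotient of \<open>g\<close> along
  \<open>\<Phi> (p\<^sub>k, -)\<close> is compared with one along \<open>\<Phi> (p, -)\<close> that starts at the same point of the
  manifold: \<open>\<Phi> (p, -)\<close> is open at \<open>0\<close>, so the starting point has a preimage \<open>w\<^sub>k\<close>, the two end
  points differ by \<open>o(t)\<close>, and \<open>g\<close> is locally Lipschitz
  (\<open>transport_difference_quotients\<close>).

  Two steps use continuity of the gradient of \<open>f\<close> at \<open>x\<close>: the passage to the limit in the linear
  term of the model, and the splitting of the difference quotients of \<open>f + g\<close>, which rests on
  strict differentiability of \<open>f\<close>. If \<open>F x < F x0\<close>, then \<open>x\<close> is interior to the sublevel set, and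
  there a differentiable function with uniform quadratic upper bounds automatically has a
  continuous gradient (\<open>grad_coord_continuous\<close>). If \<open>F x = F x0\<close>, the decrease forces every step
  to vanish, so \<open>x = x0\<close>, where continuity is assumed.
\<close>

section \<open>Strict differentiability\<close>

text \<open>The two points of the increment move independently. This is what difference quotients with
  moving base points require; differentiability at \<open>x\<close> fixes one of them.\<close>

definition has_strict_derivative ::
  "('a::real_normed_vector \<Rightarrow> 'b::real_normed_vector) \<Rightarrow> ('a \<Rightarrow> 'b) \<Rightarrow> 'a \<Rightarrow> bool" where
  "has_strict_derivative h h' x \<longleftrightarrow> bounded_linear h' \<and>
     (\<forall>e>0. \<exists>d>0. \<forall>y\<in>ball x d. \<forall>z\<in>ball x d. norm (h y - h z - h' (y - z)) \<le> e * norm (y - z))"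

text \<open>Mean value inequality for \<open>h\<close> minus its derivative at \<open>x\<close>. Continuity of the derivative
  at the single point \<open>x\<close> is enough, because every estimate compares with that one linear map.\<close>

lemma has_strict_derivativeI:
  fixes h :: "'a::euclidean_space \<Rightarrow> 'b::real_normed_vector"
  assumes S: "open S" "x \<in> S"
    and diff: "\<And>y. y \<in> S \<Longrightarrow> h differentiable (at y)"
    and cont: "\<And>v. isCont (\<lambda>y. frechet_derivative h (at y) v) x"
  shows "has_strict_derivative h (frechet_derivative h (at x)) x"
  unfolding has_strict_derivative_def
proof (intro conjI allI impI)
  let ?D = "\<lambda>y. frechet_derivative h (at y)"
  have der: "(h has_derivative ?D y) (at y)" if "y \<in> S" for y
    using diff[OF that] by (simp add: frechet_derivative_works)
  have bl: "bounded_linear (?D y)" if "y \<in> S" for y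
    using der[OF that] by (rule has_derivative_bounded_linear)
  show "bounded_linear (?D x)" using S bl by blast
  fix e :: real assume e: "e > 0"
  have "((\<lambda>y. \<Sum>b\<in>Basis. norm (?D y b - ?D x b)) \<longlongrightarrow> (\<Sum>b\<in>Basis. norm (?D x b - ?D x b))) (at x)"
    using cont by (intro tendsto_intros) (simp add: isCont_def)
  then have "\<forall>\<^sub>F y in at x. (\<Sum>b\<in>Basis. norm (?D y b - ?D x b)) < e"
    using e by (intro order_tendstoD(2)) auto
  moreover have "\<forall>\<^sub>F y in at x. y \<in> S"
    using S by (auto simp: eventually_at_topological)
  ultimately have "\<forall>\<^sub>F y in at x. y \<in> S \<and> (\<Sum>b\<in>Basis. norm (?D y b - ?D x b)) < e"
    by eventually_elim auto
  then obtain d where d: "d > 0"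
    and dS: "\<And>y. y \<noteq> x \<Longrightarrow> dist y x < d \<Longrightarrow> y \<in> S \<and> (\<Sum>b\<in>Basis. norm (?D y b - ?D x b)) < e"
    unfolding eventually_at by auto
  have near: "y \<in> S \<and> (\<Sum>b\<in>Basis. norm (?D y b - ?D x b)) < e" if "y \<in> ball x d" for y
    using dS[of y] that S e by (cases "y = x") (auto simp: dist_commute)
  show "\<exists>d>0. \<forall>y\<in>ball x d. \<forall>z\<in>ball x d. norm (h y - h z - ?D x (y - z)) \<le> e * norm (y - z)"
  proof (intro exI[of _ d] conjI ballI d)
    fix y z assume yz: "y \<in> ball x d" "z \<in> ball x d"
    have "norm ((h y - ?D x y) - (h z - ?D x z)) \<le> e * norm (y - z)"
    proof (rule differentiable_bound[where S = "ball x d" and f' = "\<lambda>y u. ?D y u - ?D x u"])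
      fix w assume w: "w \<in> ball x d"
      have wS: "w \<in> S" using near[OF w] by simp
      have "((\<lambda>y. h y - ?D x y) has_derivative (\<lambda>u. ?D w u - ?D x u)) (at w)"
        by (intro has_derivative_diff der[OF wS] bounded_linear_imp_has_derivative bl S)
      then show "((\<lambda>y. h y - ?D x y) has_derivative (\<lambda>u. ?D w u - ?D x u)) (at w within ball x d)"
        by (rule has_derivative_at_withinI)
      have "onorm (\<lambda>u. ?D w u - ?D x u) \<le> (\<Sum>b\<in>Basis. norm (?D w b - ?D x b))"
        by (intro onorm_componentwise bounded_linear_sub bl wS S)
      then show "onorm (\<lambda>u. ?D w u - ?D x u) \<le> e" using near[OF w] by simp
    qed (use yz in auto)
    then show "norm (h y - h z - ?D x (y - z)) \<le> e * norm (y - z)"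
      using bounded_linear.linear[OF bl[OF S(2)]] by (simp add: linear_diff algebra_simps)
  qed
qed

lemma has_strict_derivative_quotient:
  assumes h: "has_strict_derivative h h' x"
    and y: "(y \<longlongrightarrow> x) F" and z: "(z \<longlongrightarrow> x) F"
    and t: "\<forall>\<^sub>F n in F. 0 < t n"
    and w: "((\<lambda>n. (y n - z n) /\<^sub>R t n) \<longlongrightarrow> w) F"
  shows "((\<lambda>n. (h (y n) - h (z n)) /\<^sub>R t n) \<longlongrightarrow> h' w) F"
proof -
  interpret h': bounded_linear h' using h by (simp add: has_strict_derivative_def)
  have "((\<lambda>n. (h (y n) - h (z n)) /\<^sub>R t n - h' ((y n - z n) /\<^sub>R t n)) \<longlongrightarrow> 0) F"
  proof (rule tendstoI)
    fix e :: real assume e: "e > 0"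
    let ?M = "norm w + 1"
    have M: "?M > 0" by (simp add: add_nonneg_pos)
    with e have "e / ?M > 0" by simp
    then obtain d where d: "d > 0" "\<And>y z. y \<in> ball x d \<Longrightarrow> z \<in> ball x d \<Longrightarrow>
        norm (h y - h z - h' (y - z)) \<le> e / ?M * norm (y - z)"
      using h unfolding has_strict_derivative_def by meson
    have "\<forall>\<^sub>F n in F. norm ((y n - z n) /\<^sub>R t n) < ?M"
      using tendsto_norm[OF w] by (rule order_tendstoD) simp
    moreover have "\<forall>\<^sub>F n in F. y n \<in> ball x d" "\<forall>\<^sub>F n in F. z n \<in> ball x d"
      using y z d(1) by (auto simp: tendsto_iff dist_commute)
    ultimately show "\<forall>\<^sub>F n in F. dist ((h (y n) - h (z n)) /\<^sub>R t n - h' ((y n - z n) /\<^sub>R t n)) 0 < e"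
      using t
    proof eventually_elim
      case (elim n)
      have "norm ((h (y n) - h (z n)) /\<^sub>R t n - h' ((y n - z n) /\<^sub>R t n))
          = norm ((h (y n) - h (z n) - h' (y n - z n)) /\<^sub>R t n)"
        by (simp only: h'.scaleR) (simp only: scaleR_diff_right)
      also have "\<dots> = norm (h (y n) - h (z n) - h' (y n - z n)) / t n"
        using elim(4) by (simp add: divide_inverse mult.commute)
      also have "\<dots> \<le> (e / ?M * norm (y n - z n)) / t n"
        using elim(4) by (intro divide_right_mono d(2)[OF elim(2,3)]) simp
      also have "\<dots> = e / ?M * norm ((y n - z n) /\<^sub>R t n)"
        using elim(4) by (simp add: divide_inverse mult.commute)
      also have "\<dots> < e / ?M * ?M"
        using elim(1) e M by (intro mult_strict_left_mono) auto
      also have "\<dots> = e" using M by simp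
      finally show ?case by simp
    qed
  qed
  from tendsto_add[OF this h'.tendsto[OF w]] show ?thesis by simp
qed

lemma has_strict_derivative_imp_has_derivative:
  assumes "has_strict_derivative h h' x"
  shows "(h has_derivative h') (at x)"
  unfolding has_derivative_at_alt
proof (intro conjI allI impI)
  show "bounded_linear h'" using assms by (simp add: has_strict_derivative_def)
  fix e :: real assume "e > 0"
  then obtain d where "d > 0" "\<And>y z. y \<in> ball x d \<Longrightarrow> z \<in> ball x d \<Longrightarrow>
        norm (h y - h z - h' (y - z)) \<le> e * norm (y - z)"
    using assms unfolding has_strict_derivative_def by meson
  then show "\<exists>d>0. \<forall>y. norm (y - x) < d \<longrightarrow> norm (h y - h x - h' (y - x)) \<le> e * norm (y - x)"
    by (intro exI[of _ d]) (auto simp: dist_norm norm_minus_commute)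
qed

text \<open>The part of the inverse function theorem that the argument uses: preimages exist because
  \<open>h\<close> is open at \<open>x\<close> (Sussmann), and they converge because strict differentiability gives
  \<open>norm (w - x) \<le> 2 * norm (h w - h x)\<close> near \<open>x\<close>.\<close>

lemma strict_inverse_along:
  fixes h :: "'a::euclidean_space \<Rightarrow> 'a"
  assumes h: "has_strict_derivative h (\<lambda>v. v) x"
    and S: "open S" "x \<in> S" "continuous_on S h"
    and a: "(a \<longlongrightarrow> h x) F"
  shows "\<exists>w. (w \<longlongrightarrow> x) F \<and> (\<forall>\<^sub>F n in F. h (w n) = a n)"
proof -
  obtain d where d: "d > 0" and lip: "\<And>y z. y \<in> ball x d \<Longrightarrow> z \<in> ball x d \<Longrightarrow>
        norm (h y - h z - (y - z)) \<le> 1/2 * norm (y - z)"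
    using h unfolding has_strict_derivative_def by (meson half_gt_zero zero_less_one)
  obtain d' where d': "d' > 0" "d' \<le> d" "ball x d' \<subseteq> S"
  proof -
    obtain e where "e > 0" "ball x e \<subseteq> S" using S open_contains_ball by blast
    with d show ?thesis by (intro that[of "min d e"]) auto
  qed
  have "h x \<in> interior (h ` ball x d')"
    by (rule sussmann_open_mapping[where S = S and f' = "\<lambda>v. v" and g' = "\<lambda>v. v"])
       (simp_all add: S d' has_strict_derivative_imp_has_derivative[OF h] o_def id_def
          bounded_linear_ident interior_open)
  then have "\<forall>\<^sub>F n in F. a n \<in> interior (h ` ball x d')"
    using a by (auto intro: topological_tendstoD)
  then have ev: "\<forall>\<^sub>F n in F. \<exists>w. w \<in> ball x d' \<and> h w = a n"
    by (rule eventually_mono) (drule subsetD[OF interior_subset], erule imageE, metis)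
  define w where "w n = (SOME w. w \<in> ball x d' \<and> h w = a n)" for n
  have w: "\<forall>\<^sub>F n in F. w n \<in> ball x d' \<and> h (w n) = a n"
    using ev by eventually_elim (unfold w_def, rule someI_ex)
  have "((\<lambda>n. 2 * norm (a n - h x)) \<longlongrightarrow> 2 * norm (h x - h x)) F"
    by (intro tendsto_intros a)
  then have lim0: "((\<lambda>n. 2 * norm (a n - h x)) \<longlongrightarrow> 0) F" by simp
  have "((\<lambda>n. w n - x) \<longlongrightarrow> 0) F"
  proof (rule Lim_null_comparison[OF _ lim0])
    show "\<forall>\<^sub>F n in F. norm (w n - x) \<le> 2 * norm (a n - h x)"
      using w
    proof eventually_elim
      case (elim n)
      have "norm (h (w n) - h x - (w n - x)) \<le> 1/2 * norm (w n - x)"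
        using elim d' d by (intro lip) auto
      moreover have "norm (w n - x) \<le> norm (h (w n) - h x) + norm (h (w n) - h x - (w n - x))"
        using norm_triangle_ineq4[of "h (w n) - h x" "h (w n) - h x - (w n - x)"] by simp
      ultimately show ?case using elim by simp
    qed
  qed
  then have "(w \<longlongrightarrow> x) F" by (simp add: LIM_zero_cancel)
  moreover have "\<forall>\<^sub>F n in F. h (w n) = a n" using w by eventually_elim simp
  ultimately show ?thesis by blast
qed

section \<open>Nonnegative Clarke directional derivatives\<close>

text \<open>Stationarity at \<open>u\<close> says that the Clarke derivative is nonnegative in every direction. This
  form of it involves only individual difference quotients, which can be carried from one function
  to another without any calculus of limits superior.\<close>

lemma clarke_dd_nonneg_iff:
  "0 \<le> clarke_dd l u v \<longleftrightarrow>
     (\<forall>e>0. \<exists>y t. dist y u < e \<and> 0 < t \<and> t < e \<and> - e < (l (y + t *\<^sub>R v) - l y) / t)"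
  (is "_ \<longleftrightarrow> ?R")
proof
  let ?q = "\<lambda>y t. (l (y + t *\<^sub>R v) - l y) / t"
  assume nonneg: "0 \<le> clarke_dd l u v"
  show ?R
  proof (rule ccontr)
    assume "\<not> ?R"
    then obtain e where e: "e > 0"
      and small: "\<And>y t. dist y u < e \<Longrightarrow> 0 < t \<Longrightarrow> t < e \<Longrightarrow> ?q y t \<le> - e"
      by (meson not_le)
    have "\<forall>\<^sub>F (y, t) in nhds u \<times>\<^sub>F at_right (0::real). ereal (?q y t) \<le> ereal (- e)"
      unfolding eventually_prod_filter
      using e small by (intro exI[of _ "\<lambda>y. dist y u < e"] exI[of _ "\<lambda>t. 0 < t \<and> t < e"])
        (auto simp: eventually_nhds_metric eventually_at_right[of 0 "1::real"])
    then have "clarke_dd l u v \<le> ereal (- e)"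
      unfolding clarke_dd_def by (intro Limsup_bounded) (simp add: case_prod_unfold)
    also have "\<dots> < 0" using e by simp
    finally show False using nonneg by simp
  qed
next
  let ?q = "\<lambda>y t. (l (y + t *\<^sub>R v) - l y) / t"
  assume R: ?R
  show "0 \<le> clarke_dd l u v"
  proof (rule ccontr)
    assume "\<not> 0 \<le> clarke_dd l u v"
    then obtain r where r: "clarke_dd l u v < ereal r" "r < 0"
      using ereal_dense2[of "clarke_dd l u v" 0] by (auto simp: not_le)
    have "\<forall>\<^sub>F (y, t) in nhds u \<times>\<^sub>F at_right (0::real). ereal (?q y t) < ereal r"
      using Limsup_lessD[OF r(1)[unfolded clarke_dd_def]] by (simp add: case_prod_unfold)
    then obtain P Q where P: "eventually P (nhds u)" and Q: "eventually Q (at_right (0::real))"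
      and PQ: "\<And>y t. P y \<Longrightarrow> Q t \<Longrightarrow> ?q y t < r"
      unfolding eventually_prod_filter by auto
    obtain d1 where d1: "d1 > 0" "\<And>y. dist y u < d1 \<Longrightarrow> P y"
      using P by (auto simp: eventually_nhds_metric)
    obtain d2 where d2: "d2 > 0" "\<And>t. 0 < t \<Longrightarrow> t < d2 \<Longrightarrow> Q t"
      using Q by (auto simp: eventually_at_right[of 0 "1::real"])
    let ?e = "min (- r) (min d1 d2)"
    have "?e > 0" using r(2) d1(1) d2(1) by simp
    then obtain y t where yt: "dist y u < ?e" "0 < t" "t < ?e" "- ?e < ?q y t"
      using R by blast
    then have "?q y t < r" using d1 d2 PQ by auto
    with yt(4) show False by linarith
  qed
qed

lemma clarke_dd_linear_image:
  fixes T :: "'e::euclidean_space \<Rightarrow> 'e"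
  assumes T: "linear T" "inj T" and nonneg: "0 \<le> clarke_dd l (T u) (T v)"
  shows "0 \<le> clarke_dd (\<lambda>u. l (T u)) u v"
  unfolding clarke_dd_nonneg_iff
proof (intro allI impI)
  fix e :: real assume e: "e > 0"
  obtain S where S: "linear S" "\<And>u. S (T u) = u" "\<And>y. T (S y) = y"
    using linear_injective_isomorphism[OF T] by blast
  have "isCont S (T u)" by (simp add: S(1) linear_continuous_at linear_conv_bounded_linear[symmetric])
  then obtain d where d: "d > 0" "\<And>y. dist y (T u) < d \<Longrightarrow> dist (S y) u < e"
    using e by (metis S(2) continuous_at_eps_delta)
  obtain y t where yt: "dist y (T u) < min d e" "0 < t" "t < min d e"
      "- min d e < (l (y + t *\<^sub>R T v) - l y) / t"
    using nonneg d(1) e unfolding clarke_dd_nonneg_iff by (meson min_less_iff_conj)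
  have "y + t *\<^sub>R T v = T (S y + t *\<^sub>R v)" "y = T (S y)"
    using T(1) by (simp_all add: linear_add linear_scale S(3))
  with yt d show "\<exists>y t. dist y u < e \<and> 0 < t \<and> t < e \<and> - e < (l (T (y + t *\<^sub>R v)) - l (T y)) / t"
    by (intro exI[of _ "S y"] exI[of _ t]) auto
qed

section \<open>Convergent families of bilinear forms\<close>

lemma bilinear_entries:
  fixes B :: "'e::euclidean_space \<Rightarrow> 'e \<Rightarrow> real"
  assumes "bilinear B"
  shows "B u v = (\<Sum>i\<in>Basis. \<Sum>j\<in>Basis. (u \<bullet> i) * (v \<bullet> j) * B i j)"
proof -
  have "B u v = B (\<Sum>i\<in>Basis. (u \<bullet> i) *\<^sub>R i) (\<Sum>j\<in>Basis. (v \<bullet> j) *\<^sub>R j)"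
    by (simp add: euclidean_representation)
  also have "\<dots> = (\<Sum>i\<in>Basis. \<Sum>j\<in>Basis. (u \<bullet> i) * (v \<bullet> j) * B i j)"
    using assms by (simp add: bilinear_sum sum.cartesian_product bilinear_lmul bilinear_rmul mult.assoc case_prod_unfold)
  finally show ?thesis .
qed

lemma tendsto_bilinear_family:
  fixes B :: "'i \<Rightarrow> 'e::euclidean_space \<Rightarrow> 'e \<Rightarrow> real"
  assumes "\<And>u v. ((\<lambda>n. B n u v) \<longlongrightarrow> B0 u v) F"
    and "\<forall>\<^sub>F n in F. bilinear (B n)" "bilinear B0"
    and "(x \<longlongrightarrow> u) F" "(y \<longlongrightarrow> v) F"
  shows "((\<lambda>n. B n (x n) (y n)) \<longlongrightarrow> B0 u v) F"
proof -
  have "((\<lambda>n. \<Sum>i\<in>Basis. \<Sum>j\<in>Basis. (x n \<bullet> i) * (y n \<bullet> j) * B n i j) \<longlongrightarrow>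
      (\<Sum>i\<in>Basis. \<Sum>j\<in>Basis. (u \<bullet> i) * (v \<bullet> j) * B0 i j)) F"
    using assms by (intro tendsto_intros)
  moreover have "\<forall>\<^sub>F n in F. (\<Sum>i\<in>Basis. \<Sum>j\<in>Basis. (x n \<bullet> i) * (y n \<bullet> j) * B n i j) = B n (x n) (y n)"
    using assms(2) by eventually_elim (rule bilinear_entries[symmetric])
  ultimately show ?thesis
    unfolding bilinear_entries[OF assms(3), of u v] by (rule Lim_transform_eventually)
qed

text \<open>The entries of the forms converge, so the forms converge uniformly on the unit sphere, where
  the positive definite limit is bounded below by compactness.\<close>

lemma eventually_coercive:
  fixes B :: "'i \<Rightarrow> 'e::euclidean_space \<Rightarrow> 'e \<Rightarrow> real"
  assumes lim: "\<And>u v. ((\<lambda>n. B n u v) \<longlongrightarrow> B0 u v) F"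
    and bil: "\<forall>\<^sub>F n in F. bilinear (B n)" and bil0: "bilinear B0"
    and pos: "\<And>u. u \<noteq> 0 \<Longrightarrow> 0 < B0 u u"
  shows "\<exists>m>0. \<forall>\<^sub>F n in F. \<forall>u. m * (norm u)\<^sup>2 \<le> B n u u"
proof -
  have cont: "continuous_on (sphere 0 1) (\<lambda>u. B0 u u)"
    using bil0 unfolding bilinear_conv_bounded_bilinear
    by (rule bounded_bilinear.continuous_on[OF _ continuous_on_id continuous_on_id])
  have ne: "sphere (0::'e) 1 \<noteq> {}" by simp
  obtain u0 where u0: "u0 \<in> sphere (0::'e) 1" "\<And>u. u \<in> sphere 0 1 \<Longrightarrow> B0 u0 u0 \<le> B0 u u"
    using continuous_attains_inf[OF compact_sphere ne cont] by blast
  define m where "m = B0 u0 u0 / 2"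
  have m: "m > 0" using u0(1) pos[of u0] unfolding m_def by force
  have "((\<lambda>n. \<Sum>i\<in>(Basis::'e set). \<Sum>j\<in>(Basis::'e set). \<bar>B n i j - B0 i j\<bar>) \<longlongrightarrow> (\<Sum>i\<in>(Basis::'e set). \<Sum>j\<in>(Basis::'e set). \<bar>B0 i j - B0 i j\<bar>)) F"
    using lim by (intro tendsto_intros)
  then have "\<forall>\<^sub>F n in F. (\<Sum>i\<in>(Basis::'e set). \<Sum>j\<in>(Basis::'e set). \<bar>B n i j - B0 i j\<bar>) < m"
    using m by (intro order_tendstoD) auto
  with bil have "\<forall>\<^sub>F n in F. \<forall>u. m * (norm u)\<^sup>2 \<le> B n u u"
  proof eventually_elim
    case (elim n)
    show ?case
    proof
      fix u
      have unit: "m \<le> B n w w" if "norm w = 1" for w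
      proof -
        have "\<bar>B n w w - B0 w w\<bar> = \<bar>\<Sum>i\<in>Basis. \<Sum>j\<in>Basis. (w \<bullet> i) * (w \<bullet> j) * (B n i j - B0 i j)\<bar>"
          unfolding bilinear_entries[OF elim(1), of w w] bilinear_entries[OF bil0, of w w]
          by (simp add: sum_subtractf algebra_simps)
        also have "\<dots> \<le> (\<Sum>i\<in>Basis. \<Sum>j\<in>Basis. \<bar>(w \<bullet> i) * (w \<bullet> j) * (B n i j - B0 i j)\<bar>)"
          by (intro order_trans[OF sum_abs] sum_mono sum_abs)
        also have "\<dots> \<le> (\<Sum>i\<in>Basis. \<Sum>j\<in>Basis. \<bar>B n i j - B0 i j\<bar>)"
        proof (intro sum_mono)
          fix i j :: 'e assume "i \<in> Basis" "j \<in> Basis"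
          then have "\<bar>w \<bullet> i\<bar> * \<bar>w \<bullet> j\<bar> \<le> 1 * 1"
            using Basis_le_norm[of i w] Basis_le_norm[of j w] that by (intro mult_mono) auto
          then show "\<bar>(w \<bullet> i) * (w \<bullet> j) * (B n i j - B0 i j)\<bar> \<le> \<bar>B n i j - B0 i j\<bar>"
            by (simp add: abs_mult mult_left_le_one_le)
        qed
        also have "\<dots> < m" by (rule elim(2))
        finally have "\<bar>B n w w - B0 w w\<bar> < m" .
        moreover have "2 * m \<le> B0 w w" using u0(2)[of w] that by (simp add: m_def)
        ultimately show ?thesis by linarith
      qed
      show "m * (norm u)\<^sup>2 \<le> B n u u"
      proof (cases "u = 0")
        case True
        then show ?thesis using elim(1) by (simp add: bilinear_lzero)
      next
        case False
        have "u = norm u *\<^sub>R (u /\<^sub>R norm u)" using False by simp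
        then have "B n u u = norm u * (norm u * B n (u /\<^sub>R norm u) (u /\<^sub>R norm u))"
          using bilinear_lmul[OF elim(1)] bilinear_rmul[OF elim(1)] by (metis real_scaleR_def)
        also have "\<dots> \<ge> norm u * (norm u * m)"
          using False by (intro mult_left_mono unit) auto
        finally show ?thesis by (simp add: power2_eq_square mult_ac)
      qed
    qed
  qed
  with m show ?thesis by blast
qed

text \<open>Riesz representation for the inner product \<open>B\<close>: the map sending \<open>w\<close> to the Euclidean
  representative of \<open>B w\<close> is linear and injective, hence bijective in finite dimension.\<close>

lemma inner_product_representation:
  fixes B :: "'e::euclidean_space \<Rightarrow> 'e \<Rightarrow> real"
  assumes B: "bilinear B" and pos: "\<And>u. u \<noteq> 0 \<Longrightarrow> 0 < B u u" and D: "linear D"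
  shows "\<exists>!w. \<forall>u. B w u = D u"
proof -
  define J where "J w = (\<Sum>b\<in>Basis. B w b *\<^sub>R b)" for w
  have JB: "J w \<bullet> u = B w u" for w u
  proof -
    have "B w u = B w (\<Sum>b\<in>Basis. (u \<bullet> b) *\<^sub>R b)" by (simp add: euclidean_representation)
    also have "\<dots> = (\<Sum>b\<in>Basis. (u \<bullet> b) * B w b)"
      using B by (simp add: bilinear_def linear_sum linear_scale)
    finally show ?thesis by (simp add: J_def inner_sum_left inner_commute[of u] mult.commute)
  qed
  have lin: "linear J"
    using B by (intro linearI)
      (simp_all add: J_def bilinear_ladd bilinear_lmul scaleR_add_left sum.distrib scaleR_sum_right)
  have inj: "inj J"
  proof -
    have "w = 0" if "J w = 0" for w using JB[of w w] that pos[of w] by fastforce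
    then show ?thesis using lin linear_injective_0 by blast
  qed
  have "surj J" using lin inj by (rule linear_injective_imp_surjective) simp
  then obtain w where w: "J w = (\<Sum>b\<in>Basis. D b *\<^sub>R b)" by (metis surjD)
  have "B w u = D u" for u
  proof -
    have "D u = D (\<Sum>b\<in>Basis. (u \<bullet> b) *\<^sub>R b)" by (simp add: euclidean_representation)
    also have "\<dots> = (\<Sum>b\<in>Basis. (u \<bullet> b) * D b)" using D by (simp add: linear_sum linear_scale)
    finally show ?thesis
      unfolding JB[symmetric] w by (simp add: inner_sum_left inner_commute[of u] mult.commute)
  qed
  moreover have "w' = w" if "\<forall>u. B w' u = D u" for w'
  proof -
    have "J w' \<bullet> u = J w \<bullet> u" for u using that calculation by (simp add: JB)
    then have "J w' = J w" by (metis vector_eq_ldot inner_commute)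
    then show ?thesis using inj by (simp add: inj_eq)
  qed
  ultimately show ?thesis by blast
qed

section \<open>Transport of difference quotients between tangent spaces\<close>

lemma has_strict_derivative_slice:
  assumes "has_strict_derivative h h' (p, u)"
  shows "has_strict_derivative (\<lambda>v. h (p, v)) (\<lambda>v. h' (0, v)) u"
  unfolding has_strict_derivative_def
proof (intro conjI allI impI)
  have h': "bounded_linear h'" using assms by (simp add: has_strict_derivative_def)
  show "bounded_linear (\<lambda>v. h' (0, v))"
    by (rule bounded_linear_compose[OF h']) (intro bounded_linear_Pair bounded_linear_zero bounded_linear_ident)
  fix e :: real assume "e > 0"
  then obtain d where d: "d > 0" "\<And>y z. y \<in> ball (p, u) d \<Longrightarrow> z \<in> ball (p, u) d \<Longrightarrow>
        norm (h y - h z - h' (y - z)) \<le> e * norm (y - z)"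
    using assms unfolding has_strict_derivative_def by meson
  show "\<exists>d>0. \<forall>y\<in>ball u d. \<forall>z\<in>ball u d.
      norm (h (p, y) - h (p, z) - h' (0, y - z)) \<le> e * norm (y - z)"
  proof (intro exI[of _ d] conjI ballI d(1))
    fix y z assume "y \<in> ball u d" "z \<in> ball u d"
    then have "(p, y) \<in> ball (p, u) d" "(p, z) \<in> ball (p, u) d" by (simp_all add: dist_Pair_Pair)
    from d(2)[OF this] show "norm (h (p, y) - h (p, z) - h' (0, y - z)) \<le> e * norm (y - z)"
      by (simp add: norm_Pair)
  qed
qed

text \<open>Here \<open>\<Phi>\<close> is a retraction in coordinates, and \<open>f\<close>, \<open>g\<close> are functions in the chart. The
  quotients of \<open>g\<close> along the moving maps \<open>\<Phi> (P n, -)\<close> start at \<open>a n = \<Phi> (P n, u n)\<close>. Choosing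
  \<open>w n\<close> with \<open>\<Phi> (p, w n) = a n\<close> gives quotients along the fixed map \<open>\<Phi> (p, -)\<close> with the same
  starting point. Both end points are \<open>a n + t n *\<^sub>R v + o(t n)\<close>, so the Lipschitz property of
  \<open>g\<close> makes the two quotients of \<open>g\<close> asymptotically equal, and those of \<open>f\<close> tend to \<open>f' v\<close>,
  which cancels the limit of the lower bounds \<open>\<rho>\<close>.\<close>

lemma transport_difference_quotients:
  fixes \<Phi> :: "'e::euclidean_space \<times> 'e \<Rightarrow> 'e" and f g :: "'e \<Rightarrow> real"
  assumes \<Phi>: "has_strict_derivative \<Phi> D (p, 0)" "\<And>v. D (0, v) = v" "\<Phi> (p, 0) = p"
    and W: "open W" "(p, 0) \<in> W" "continuous_on W \<Phi>"
    and f: "has_strict_derivative f f' p"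
    and g: "r > 0" "K-lipschitz_on (ball p r) g"
    and P: "(P \<longlongrightarrow> p) F" and u: "(u \<longlongrightarrow> 0) F" and t: "(t \<longlongrightarrow> 0) F" "\<forall>\<^sub>F n in F. 0 < t n"
    and F: "F \<noteq> bot"
    and \<rho>: "(\<rho> \<longlongrightarrow> - f' v) F"
    and quot: "\<forall>\<^sub>F n in F. \<rho> n \<le> (g (\<Phi> (P n, u n + t n *\<^sub>R v)) - g (\<Phi> (P n, u n))) / t n"
    and e: "e > 0"
  shows "\<exists>y s. norm y < e \<and> 0 < s \<and> s < e \<and>
    - e < ((f (\<Phi> (p, y + s *\<^sub>R v)) + g (\<Phi> (p, y + s *\<^sub>R v))) - (f (\<Phi> (p, y)) + g (\<Phi> (p, y)))) / s"
proof -
  let ?h = "\<lambda>u. \<Phi> (p, u)"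
  have strict_h: "has_strict_derivative ?h (\<lambda>v. v) 0"
    using has_strict_derivative_slice[OF \<Phi>(1)] by (simp add: \<Phi>(2))
  have cont\<Phi>: "isCont \<Phi> (p, 0)"
    using has_strict_derivative_imp_has_derivative[OF \<Phi>(1)] has_derivative_continuous by blast
  have cont_h: "isCont ?h 0"
    using has_strict_derivative_imp_has_derivative[OF strict_h] has_derivative_continuous by blast
  have tv: "((\<lambda>n. t n *\<^sub>R v) \<longlongrightarrow> 0) F"
    using tendsto_scaleR[OF t(1) tendsto_const[of v]] by simp
  have Pu: "((\<lambda>n. (P n, u n)) \<longlongrightarrow> (p, 0)) F" by (intro tendsto_Pair P u)
  have Putv: "((\<lambda>n. (P n, u n + t n *\<^sub>R v)) \<longlongrightarrow> (p, 0)) F"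
    using tendsto_Pair[OF P tendsto_add[OF u tv]] by simp
  define a where "a n = \<Phi> (P n, u n)" for n
  define b' where "b' n = \<Phi> (P n, u n + t n *\<^sub>R v)" for n
  have a: "(a \<longlongrightarrow> p) F"
    unfolding a_def using isCont_tendsto_compose[OF cont\<Phi> Pu] by (simp add: \<Phi>(3))
  have b': "(b' \<longlongrightarrow> p) F"
    unfolding b'_def using isCont_tendsto_compose[OF cont\<Phi> Putv] by (simp add: \<Phi>(3))
  have "open (Pair p -` W)" using W(1) by (intro open_vimage continuous_intros)
  moreover have "continuous_on (Pair p -` W) ?h"
    by (rule continuous_on_compose2[OF W(3)]) (auto intro!: continuous_intros)
  ultimately obtain w where w: "(w \<longlongrightarrow> 0) F" and hw: "\<forall>\<^sub>F n in F. ?h (w n) = a n"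
    using strict_inverse_along[OF strict_h _ _ _, of "Pair p -` W" a F] W(2) a \<Phi>(3) by auto
  define b where "b n = \<Phi> (p, w n + t n *\<^sub>R v)" for n
  have wtv: "((\<lambda>n. w n + t n *\<^sub>R v) \<longlongrightarrow> 0) F" using tendsto_add[OF w tv] by simp
  have b: "(b \<longlongrightarrow> p) F"
    unfolding b_def using isCont_tendsto_compose[OF cont_h wtv] by (simp add: \<Phi>(3))
  have "((\<lambda>n. ((w n + t n *\<^sub>R v) - w n) /\<^sub>R t n) \<longlongrightarrow> v) F"
    by (rule tendsto_eventually) (use t(2) in eventually_elim, simp)
  from has_strict_derivative_quotient[OF strict_h wtv w t(2) this]
  have "((\<lambda>n. (b n - ?h (w n)) /\<^sub>R t n) \<longlongrightarrow> v) F" by (simp add: b_def)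
  moreover have "\<forall>\<^sub>F n in F. (b n - ?h (w n)) /\<^sub>R t n = (b n - a n) /\<^sub>R t n"
    using hw by eventually_elim simp
  ultimately have q1: "((\<lambda>n. (b n - a n) /\<^sub>R t n) \<longlongrightarrow> v) F"
    by (rule Lim_transform_eventually)
  have "((\<lambda>n. ((P n, u n + t n *\<^sub>R v) - (P n, u n)) /\<^sub>R t n) \<longlongrightarrow> (0, v)) F"
    by (rule tendsto_eventually) (use t(2) in eventually_elim, simp)
  from has_strict_derivative_quotient[OF \<Phi>(1) Putv Pu t(2) this]
  have q2: "((\<lambda>n. (b' n - a n) /\<^sub>R t n) \<longlongrightarrow> v) F" by (simp add: b'_def a_def \<Phi>(2))
  have q3: "((\<lambda>n. (f (b n) - f (a n)) /\<^sub>R t n) \<longlongrightarrow> f' v) F"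
    by (rule has_strict_derivative_quotient[OF f b a t(2) q1])
  have "((\<lambda>n. (f (b n) - f (a n)) /\<^sub>R t n + \<rho> n
      - K * norm ((b n - a n) /\<^sub>R t n - (b' n - a n) /\<^sub>R t n)) \<longlongrightarrow> f' v + - f' v - K * norm (v - v)) F"
    by (intro tendsto_intros q1 q2 q3 \<rho>)
  then have "\<forall>\<^sub>F n in F. - e < (f (b n) - f (a n)) /\<^sub>R t n + \<rho> n
      - K * norm ((b n - a n) /\<^sub>R t n - (b' n - a n) /\<^sub>R t n)"
    using e by (intro order_tendstoD) auto
  moreover have "\<forall>\<^sub>F n in F. norm (w n) < e" using w e by (simp add: tendsto_iff)
  moreover have "\<forall>\<^sub>F n in F. t n < e" using t(1) e by (rule order_tendstoD)
  moreover have "\<forall>\<^sub>F n in F. b n \<in> ball p r" "\<forall>\<^sub>F n in F. b' n \<in> ball p r"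
    using b b' g(1) by (auto simp: tendsto_iff dist_commute)
  ultimately have "\<forall>\<^sub>F n in F. norm (w n) < e \<and> 0 < t n \<and> t n < e \<and>
      - e < ((f (?h (w n + t n *\<^sub>R v)) + g (?h (w n + t n *\<^sub>R v))) - (f (?h (w n)) + g (?h (w n)))) / t n"
    using quot hw t(2)
  proof eventually_elim
    case (elim n)
    have "dist (g (b n)) (g (b' n)) \<le> K * dist (b n) (b' n)"
      using lipschitz_onD[OF g(2)] elim by blast
    then have "g (b' n) - g (b n) \<le> K * norm (b n - b' n)"
      by (simp add: dist_norm abs_le_iff)
    then have "(g (b' n) - g (b n)) / t n \<le> K * norm (b n - b' n) / t n"
      using elim by (simp add: divide_right_mono)
    moreover have "K * norm (b n - b' n) / t n = K * norm ((b n - a n) /\<^sub>R t n - (b' n - a n) /\<^sub>R t n)"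
    proof -
      have "(b n - a n) /\<^sub>R t n - (b' n - a n) /\<^sub>R t n = (b n - b' n) /\<^sub>R t n"
        by (simp flip: scaleR_diff_right)
      then show ?thesis using elim by (simp add: divide_inverse mult_ac)
    qed
    moreover have "\<rho> n \<le> (g (b' n) - g (a n)) / t n" using elim by (simp add: a_def b'_def)
    moreover have "((f (b n) + g (b n)) - (f (a n) + g (a n))) / t n =
        (f (b n) - f (a n)) /\<^sub>R t n + (g (b' n) - g (a n)) / t n - (g (b' n) - g (b n)) / t n"
      by (simp add: divide_inverse algebra_simps)
    ultimately have "- e < ((f (b n) + g (b n)) - (f (a n) + g (a n))) / t n"
      using elim(1) by linarith
    then show ?case using elim by (simp add: b_def)
  qed
  then obtain n where "norm (w n) < e \<and> 0 < t n \<and> t n < e \<and>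
      - e < ((f (?h (w n + t n *\<^sub>R v)) + g (?h (w n + t n *\<^sub>R v))) - (f (?h (w n)) + g (?h (w n)))) / t n"
    using eventually_happens'[OF F] by blast
  then show ?thesis by blast
qed

section \<open>Charts and coordinate representations\<close>

lemma smooth_on_C1:
  assumes "smooth_on h S"
  shows "continuous_on S h"
    and "x \<in> S \<Longrightarrow> h differentiable (at x)"
    and "continuous_on S (\<lambda>x. frechet_derivative h (at x) v)"
proof -
  have "Ck_on 0 h S" "Ck_on (Suc 0) h S" using assms by (auto simp only: smooth_on_def)
  then show "continuous_on S h" "x \<in> S \<Longrightarrow> h differentiable (at x)"
    "continuous_on S (\<lambda>x. frechet_derivative h (at x) v)" by auto
qed

lemma smooth_on_has_strict_derivative:
  assumes "smooth_on h S" "open S" "x \<in> S"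
  shows "has_strict_derivative h (frechet_derivative h (at x)) x"
proof (rule has_strict_derivativeI[OF assms(2,3)])
  show "isCont (\<lambda>y. frechet_derivative h (at y) v) x" for v
    using smooth_on_C1(3)[OF assms(1)] assms(2,3) continuous_on_eq_continuous_at by blast
qed (rule smooth_on_C1(2)[OF assms(1)])

lemma chart_at_chart:
  assumes "smooth_atlas A"
  shows "chart_at A x \<in> A" "x \<in> fst (chart_at A x)"
proof -
  have "x \<in> (\<Union>c\<in>A. fst c)" using assms unfolding smooth_atlas_def by blast
  then have "\<exists>c. c \<in> A \<and> x \<in> fst c" by blast
  then show "chart_at A x \<in> A" "x \<in> fst (chart_at A x)"
    unfolding chart_at_def by (metis (mono_tags, lifting) someI_ex)+
qed

lemma chart_simps:
  assumes A: "smooth_atlas A" and c: "c \<in> A"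
  shows "open (fst c)" "open (chart_image c)"
    and "continuous_on (fst c) (snd c)" "continuous_on (chart_image c) (chart_inv c)"
    and "p \<in> chart_image c \<Longrightarrow> chart_inv c p \<in> fst c"
    and "p \<in> chart_image c \<Longrightarrow> snd c (chart_inv c p) = p"
    and "x \<in> fst c \<Longrightarrow> snd c x \<in> chart_image c"
    and "x \<in> fst c \<Longrightarrow> chart_inv c (snd c x) = x"
proof -
  have *: "open (fst c)" "open (chart_image c)"
      "homeomorphism (fst c) (chart_image c) (snd c) (chart_inv c)"
    using A c by (auto simp: smooth_atlas_def)
  then show "open (fst c)" "open (chart_image c)"
    "continuous_on (fst c) (snd c)" "continuous_on (chart_image c) (chart_inv c)"
    "p \<in> chart_image c \<Longrightarrow> chart_inv c p \<in> fst c"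
    "p \<in> chart_image c \<Longrightarrow> snd c (chart_inv c p) = p"
    "x \<in> fst c \<Longrightarrow> snd c x \<in> chart_image c"
    "x \<in> fst c \<Longrightarrow> chart_inv c (snd c x) = x"
    by (auto simp: homeomorphism_def)
qed

lemma open_chart_vimage:
  assumes A: "smooth_atlas A" and c: "c \<in> A" and U: "open U"
  shows "open {p \<in> chart_image c. chart_inv c p \<in> U}"
proof -
  have "open (chart_inv c -` U \<inter> chart_image c)"
    using continuous_on_open_vimage[OF chart_simps(2)[OF A c]] chart_simps(4)[OF A c] U by blast
  then show ?thesis by (simp add: vimage_def Int_def conj_commute)
qed

lemma chart_overlap_image:
  assumes A: "smooth_atlas A" and c: "c \<in> A"
  shows "snd c ` (fst c \<inter> V) = {p \<in> chart_image c. chart_inv c p \<in> V}"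
  using chart_simps[OF A c] by (force simp: chart_image_def)

lemma transition_has_derivative:
  assumes A: "smooth_atlas A" and c: "c \<in> A" and p: "p \<in> chart_image c"
  shows "(snd (chart_at A (chart_inv c p)) \<circ> chart_inv c has_derivative tangent_vec A c p) (at p)"
proof -
  let ?d = "chart_at A (chart_inv c p)"
  have "smooth_on (snd ?d \<circ> chart_inv c) (snd c ` (fst c \<inter> fst ?d))"
    using A c chart_at_chart[OF A] by (auto simp: smooth_atlas_def)
  moreover have "p \<in> snd c ` (fst c \<inter> fst ?d)"
    unfolding chart_overlap_image[OF A c] using p chart_at_chart(2)[OF A] by blast
  ultimately have "(snd ?d \<circ> chart_inv c) differentiable (at p)" by (rule smooth_on_C1(2))
  moreover have "tangent_vec A c p = frechet_derivative (snd ?d \<circ> chart_inv c) (at p)"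
    by (rule ext) (simp add: tangent_vec_def)
  ultimately show ?thesis by (simp add: frechet_derivative_works)
qed

lemma linear_tangent_vec:
  assumes "smooth_atlas A" "c \<in> A" "p \<in> chart_image c"
  shows "linear (tangent_vec A c p)"
  using transition_has_derivative[OF assms] has_derivative_linear by blast

text \<open>Tangent vectors at \<open>x\<close> are represented by their coordinates in \<open>chart_at A x\<close>, so at this
  base point the change of coordinates is trivial. For this reason the limit argument works in the
  chart \<open>chart_at A x\<close> of the accumulation point.\<close>

lemma tangent_vec_chart_at:
  assumes A: "smooth_atlas A" and c: "c = chart_at A x"
  shows "tangent_vec A c (snd c x) u = u"
proof -
  have cA: "c \<in> A" "x \<in> fst c" using chart_at_chart[OF A] c by auto
  note simps = chart_simps[OF A cA(1)]
  have p: "snd c x \<in> chart_image c" and inv: "chart_inv c (snd c x) = x" using simps cA(2) by auto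
  have "(snd c \<circ> chart_inv c has_derivative tangent_vec A c (snd c x)) (at (snd c x))"
    using transition_has_derivative[OF A cA(1) p] unfolding inv c[symmetric] .
  then have "((\<lambda>p. p) has_derivative tangent_vec A c (snd c x)) (at (snd c x))"
    by (rule has_derivative_transform_within_open[OF _ simps(2) p]) (simp add: simps(6))
  then have "tangent_vec A c (snd c x) = (\<lambda>u. u)"
    using has_derivative_unique has_derivative_ident by blast
  then show ?thesis by simp
qed

definition coord_metric ::
  "('m, 'e::euclidean_space) chart set \<Rightarrow> ('m \<Rightarrow> 'e \<Rightarrow> 'e \<Rightarrow> real) \<Rightarrow> ('m, 'e) chart \<Rightarrow>
   'e \<Rightarrow> 'e \<Rightarrow> 'e \<Rightarrow> real" where
  "coord_metric A G c p u v = G (chart_inv c p) (tangent_vec A c p u) (tangent_vec A c p v)"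

definition coord_retraction ::
  "('m, 'e::euclidean_space) chart set \<Rightarrow> ('m \<Rightarrow> 'e \<Rightarrow> 'm) \<Rightarrow> ('m, 'e) chart \<Rightarrow> 'e \<times> 'e \<Rightarrow> 'e" where
  "coord_retraction A R c = (\<lambda>(p, u). snd c (R (chart_inv c p) (tangent_vec A c p u)))"

lemma riemannian_metric_at:
  assumes "riemannian_manifold A G"
  shows "bilinear (G x)" "G x u v = G x v u" "u \<noteq> 0 \<Longrightarrow> 0 < G x u u"
    and "0 \<le> G x u u" "(rnorm G x u)\<^sup>2 = G x u u" "0 \<le> rnorm G x u"
proof -
  show b: "bilinear (G x)" and "G x u v = G x v u" and pos: "u \<noteq> 0 \<Longrightarrow> 0 < G x u u"
    using assms by (auto simp: riemannian_manifold_def riemannian_metric_def)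
  show "0 \<le> G x u u"
    using pos b by (cases "u = 0") (auto simp: bilinear_lzero)
  then show "(rnorm G x u)\<^sup>2 = G x u u" "0 \<le> rnorm G x u" by (auto simp: rnorm_def)
qed

lemma bilinear_coord_metric:
  assumes M: "riemannian_manifold A G" and c: "c \<in> A" and p: "p \<in> chart_image c"
  shows "bilinear (coord_metric A G c p)"
proof -
  have T: "linear (tangent_vec A c p)"
    using M c p by (intro linear_tangent_vec) (simp add: riemannian_manifold_def)
  have G: "\<And>v. linear (\<lambda>u. G (chart_inv c p) u v)" "\<And>u. linear (G (chart_inv c p) u)"
    using riemannian_metric_at(1)[OF M] by (auto simp: bilinear_def)
  show ?thesis
    unfolding bilinear_def coord_metric_def
    using linear_compose[OF T G(1)] linear_compose[OF T G(2)] by (simp add: o_def)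
qed

lemma tendsto_coord_metric:
  assumes M: "riemannian_manifold A G" and c: "c \<in> A" and p: "p \<in> chart_image c"
    and P: "(P \<longlongrightarrow> p) F"
  shows "((\<lambda>n. coord_metric A G c (P n) u v) \<longlongrightarrow> coord_metric A G c p u v) F"
proof -
  have "smooth_on (\<lambda>p. coord_metric A G c p u v) (chart_image c)"
    using M c by (simp add: coord_metric_def riemannian_manifold_def riemannian_metric_def)
  then have "isCont (\<lambda>p. coord_metric A G c p u v) p"
    using smooth_on_C1(1) p chart_simps(2)[OF _ c] M continuous_on_eq_continuous_at
    unfolding riemannian_manifold_def by blast
  from isCont_tendsto_compose[OF this P] show ?thesis .
qed

lemma inner_grad:
  assumes M: "riemannian_manifold A G" and f: "differentiable_on_manifold A f"
  shows "G x (grad A G f x) u =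
    frechet_derivative (f \<circ> chart_inv (chart_at A x)) (at (snd (chart_at A x) x)) u"
proof -
  let ?c = "chart_at A x"
  have A: "smooth_atlas A" using M by (simp add: riemannian_manifold_def)
  have "snd ?c x \<in> chart_image ?c" using chart_at_chart[OF A] chart_simps(7)[OF A] by blast
  then have "(f \<circ> chart_inv ?c) differentiable (at (snd ?c x))"
    using f chart_at_chart(1)[OF A] by (auto simp: differentiable_on_manifold_def)
  then have "linear (frechet_derivative (f \<circ> chart_inv ?c) (at (snd ?c x)))"
    by (rule linear_frechet_derivative)
  from theI'[OF inner_product_representation[OF riemannian_metric_at(1,3)[OF M] this]]
  show ?thesis unfolding grad_def by blast
qed

lemma inner_grad_coord:
  assumes M: "riemannian_manifold A G" and f: "differentiable_on_manifold A f"
    and c: "c \<in> A" and p: "p \<in> chart_image c"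
  shows "G (chart_inv c p) (grad A G f (chart_inv c p)) (tangent_vec A c p u) =
    frechet_derivative (f \<circ> chart_inv c) (at p) u"
proof -
  have A: "smooth_atlas A" using M by (simp add: riemannian_manifold_def)
  define x where "x = chart_inv c p"
  define d where "d = chart_at A x"
  have d: "d \<in> A" "x \<in> fst d" using chart_at_chart[OF A] by (auto simp: d_def)
  have "(f \<circ> chart_inv d) differentiable (at (snd d x))"
    using f d chart_simps(7)[OF A] by (auto simp: differentiable_on_manifold_def)
  then have "(f \<circ> chart_inv d has_derivative frechet_derivative (f \<circ> chart_inv d) (at (snd d x)))
      (at ((snd d \<circ> chart_inv c) p))"
    by (simp add: frechet_derivative_works x_def)
  moreover have "(snd d \<circ> chart_inv c has_derivative tangent_vec A c p) (at p)"
    using transition_has_derivative[OF A c p] by (simp add: d_def x_def)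
  ultimately have "((f \<circ> chart_inv d) \<circ> (snd d \<circ> chart_inv c) has_derivative
      frechet_derivative (f \<circ> chart_inv d) (at (snd d x)) \<circ> tangent_vec A c p) (at p)"
    by (rule diff_chain_at[rotated])
  then have "(f \<circ> chart_inv c has_derivative
      frechet_derivative (f \<circ> chart_inv d) (at (snd d x)) \<circ> tangent_vec A c p) (at p)"
  proof (rule has_derivative_transform_within_open)
    show "open {q \<in> chart_image c. chart_inv c q \<in> fst d}"
      by (rule open_chart_vimage[OF A c chart_simps(1)[OF A d(1)]])
    show "p \<in> {q \<in> chart_image c. chart_inv c q \<in> fst d}" using p d(2) by (simp add: x_def)
  qed (simp add: chart_simps(8)[OF A d(1)])
  from frechet_derivative_at[OF this]
  have "frechet_derivative (f \<circ> chart_inv c) (at p) u =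
      frechet_derivative (f \<circ> chart_inv d) (at (snd d x)) (tangent_vec A c p u)"
    by (metis comp_apply)
  then show ?thesis using inner_grad[OF M f, of x] by (simp add: d_def x_def)
qed

text \<open>The derivative of the coordinate retraction in the fibre direction is the identity: this is
  the first-order condition on a retraction, read in the chart.\<close>

lemma coord_retraction_at_zero:
  assumes A: "smooth_atlas A" and R: "manifold_retraction A R"
    and c: "c = chart_at A x" and p: "p = snd c x"
  defines "W \<equiv> retraction_dom A R c c" and "\<Phi> \<equiv> coord_retraction A R c"
  shows "open W" "(p, 0) \<in> W" "continuous_on W \<Phi>" "\<Phi> (p, 0) = p"
    and "has_strict_derivative \<Phi> (frechet_derivative \<Phi> (at (p, 0))) (p, 0)"
    and "frechet_derivative \<Phi> (at (p, 0)) (0, v) = v"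
proof -
  have cA: "c \<in> A" "x \<in> fst c" using chart_at_chart[OF A] c by auto
  note simps = chart_simps[OF A cA(1)]
  have pI: "p \<in> chart_image c" and inv: "chart_inv c p = x" using simps cA(2) p by auto
  have T: "tangent_vec A c p u = u" for u unfolding p by (rule tangent_vec_chart_at[OF A c])
  have R0: "R x 0 = x" for x using R by (simp add: manifold_retraction_def)
  show W: "open W" and smooth: "continuous_on W \<Phi>"
    using R cA(1) smooth_on_C1(1)
    by (auto simp: W_def \<Phi>_def coord_retraction_def manifold_retraction_def smooth_bundle_map_def)
  show p0: "(p, 0) \<in> W"
    using pI cA(2) by (simp add: W_def retraction_dom_def T inv R0)
  show "\<Phi> (p, 0) = p" by (simp add: \<Phi>_def coord_retraction_def T inv R0 p[symmetric])
  have "smooth_on \<Phi> W"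
    using R cA(1)
    by (simp add: W_def \<Phi>_def coord_retraction_def manifold_retraction_def smooth_bundle_map_def)
  then show sd: "has_strict_derivative \<Phi> (frechet_derivative \<Phi> (at (p, 0))) (p, 0)"
    by (rule smooth_on_has_strict_derivative[OF _ W p0])
  have der: "(\<Phi> has_derivative frechet_derivative \<Phi> (at (p, 0))) (at (p, 0))"
    by (rule has_strict_derivative_imp_has_derivative[OF sd])
  have "((\<lambda>t::real. (p, t *\<^sub>R v)) has_vector_derivative (0, v)) (at 0)"
    unfolding has_vector_derivative_def by (auto intro!: derivative_eq_intros)
  then have "((\<Phi> \<circ> (\<lambda>t::real. (p, t *\<^sub>R v))) has_vector_derivative
      frechet_derivative \<Phi> (at (p, 0)) (0, v)) (at 0)"
    by (rule vector_derivative_diff_chain_within) (simp add: der has_derivative_at_withinI)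
  moreover have "\<Phi> \<circ> (\<lambda>t::real. (p, t *\<^sub>R v)) = (\<lambda>t. snd c (R x (t *\<^sub>R v)))"
    by (simp add: \<Phi>_def coord_retraction_def T inv fun_eq_iff)
  moreover have "((\<lambda>t. snd c (R x (t *\<^sub>R v))) has_vector_derivative v) (at 0)"
    using R by (simp add: manifold_retraction_def c)
  ultimately show "frechet_derivative \<Phi> (at (p, 0)) (0, v) = v"
    by (metis vector_derivative_unique_at)
qed

lemma coord_retraction_inv:
  assumes "smooth_atlas A" "c \<in> A" "(q, u) \<in> retraction_dom A R c c"
  shows "q \<in> chart_image c" "coord_retraction A R c (q, u) \<in> chart_image c"
    and "chart_inv c (coord_retraction A R c (q, u)) = R (chart_inv c q) (tangent_vec A c q u)"
  using assms chart_simps(7,8)[OF assms(1,2)] by (auto simp: retraction_dom_def coord_retraction_def)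

lemma retraction_smoothD:
  assumes "retraction_smooth A G R L h N" "x \<in> N" "R x u \<in> N"
  shows "h (R x u) \<le> h x + G x (grad A G h x) u + L / 2 * (rnorm G x u)\<^sup>2"
proof -
  have "R x ` {u} \<subseteq> N" using assms(3) by simp
  then show ?thesis using assms(1,2) unfolding retraction_smooth_def by blast
qed

section \<open>Continuity of the gradient inside the smoothness region\<close>

text \<open>For a fixed small step \<open>s\<close>, retraction-smoothness at \<open>q\<close> bounds the derivative at \<open>q\<close> in
  direction \<open>v\<close> from below by the difference quotient of \<open>f\<close> with step \<open>s\<close> minus \<open>O(s)\<close>. This
  bound is continuous in \<open>q\<close>, and at \<open>p\<close> it is close to the derivative at \<open>p\<close>. Hence the derivative
  is lower semicontinuous in every direction \<open>v\<close>; applied to \<open>- v\<close>, linearity gives upper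
  semicontinuity.\<close>

lemma grad_coord_continuous:
  assumes M: "riemannian_manifold A G" and R: "manifold_retraction A R"
    and f: "differentiable_on_manifold A f"
    and smooth: "retraction_smooth A G R L f N" and N: "x \<in> interior N"
    and c: "c = chart_at A x" and p: "p = snd c x"
  shows "isCont (\<lambda>q. frechet_derivative (f \<circ> chart_inv c) (at q) v) p"
proof -
  have A: "smooth_atlas A" using M by (simp add: riemannian_manifold_def)
  have cA: "c \<in> A" "x \<in> fst c" using chart_at_chart[OF A] c by auto
  note simps = chart_simps[OF A cA(1)]
  have pI: "p \<in> chart_image c" and inv: "chart_inv c p = x" using simps cA(2) p by auto
  note \<Phi> = coord_retraction_at_zero[OF A R c p]
  let ?W = "retraction_dom A R c c" and ?\<Phi> = "coord_retraction A R c"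
  let ?D = "\<lambda>q. frechet_derivative (f \<circ> chart_inv c) (at q)"
  let ?B = "coord_metric A G c"
  define fc where "fc = f \<circ> chart_inv c"
  define U where "U = {q \<in> chart_image c. chart_inv c q \<in> interior N}"
  have U: "open U" "p \<in> U"
    using open_chart_vimage[OF A cA(1), of "interior N"] pI inv N by (auto simp: U_def)
  have der: "(fc has_derivative ?D q) (at q)" if "q \<in> chart_image c" for q
    using f cA(1) that by (simp add: fc_def differentiable_on_manifold_def frechet_derivative_works)
  have lin: "linear (?D q)" if "q \<in> chart_image c" for q
    using der[OF that] has_derivative_linear by blast
  have upper: "fc (?\<Phi> (q, s *\<^sub>R v)) \<le> fc q + s * ?D q v + L / 2 * (s * (s * ?B q v v))"
    if q: "q \<in> U" and W: "(q, s *\<^sub>R v) \<in> ?W" and \<Phi>U: "?\<Phi> (q, s *\<^sub>R v) \<in> U" for q v and s :: real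
  proof -
    define y where "y = chart_inv c q"
    define w where "w = tangent_vec A c q (s *\<^sub>R v)"
    have qI: "q \<in> chart_image c" using q by (simp add: U_def)
    have Ryw: "chart_inv c (?\<Phi> (q, s *\<^sub>R v)) = R y w"
      using coord_retraction_inv(3)[OF A cA(1) W] by (simp add: y_def w_def)
    have "y \<in> N" "R y w \<in> N"
      using q \<Phi>U Ryw interior_subset by (auto simp: U_def y_def)
    then have "f (R y w) \<le> f y + G y (grad A G f y) w + L / 2 * (rnorm G y w)\<^sup>2"
      by (rule retraction_smoothD[OF smooth])
    moreover have "G y (grad A G f y) w = s * ?D q v"
      unfolding y_def w_def inner_grad_coord[OF M f cA(1) qI]
      using linear_scale[OF lin[OF qI], of s v] by simp
    moreover have "(rnorm G y w)\<^sup>2 = s * (s * ?B q v v)"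
    proof -
      have "(rnorm G y w)\<^sup>2 = ?B q (s *\<^sub>R v) (s *\<^sub>R v)"
        by (simp add: riemannian_metric_at(5)[OF M] coord_metric_def y_def w_def)
      then show ?thesis
        using bilinear_lmul[OF bilinear_coord_metric[OF M cA(1) qI]]
          bilinear_rmul[OF bilinear_coord_metric[OF M cA(1) qI]] by simp
    qed
    ultimately show ?thesis using Ryw by (simp add: fc_def y_def)
  qed
  have lower: "\<forall>\<^sub>F q in nhds p. ?D p v - e < ?D q v" if e: "e > 0" for v and e :: real
  proof -
    have path: "((\<lambda>s::real. (p, s *\<^sub>R v)) has_vector_derivative (0, v)) (at 0)"
      unfolding has_vector_derivative_def by (auto intro!: derivative_eq_intros)
    have "((?\<Phi> \<circ> (\<lambda>s::real. (p, s *\<^sub>R v))) has_vector_derivative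
        frechet_derivative ?\<Phi> (at (p, 0)) (0, v)) (at 0)"
      using path by (rule vector_derivative_diff_chain_within)
        (simp add: has_strict_derivative_imp_has_derivative[OF \<Phi>(5)] has_derivative_at_withinI)
    then have \<Phi>path: "((\<lambda>s::real. ?\<Phi> (p, s *\<^sub>R v)) has_vector_derivative v) (at 0)"
      by (simp add: o_def \<Phi>(6))
    then have "((fc \<circ> (\<lambda>s::real. ?\<Phi> (p, s *\<^sub>R v))) has_vector_derivative ?D p v) (at 0)"
      by (rule vector_derivative_diff_chain_within)
        (simp only: scaleR_zero_left \<Phi>(4), rule has_derivative_at_withinI[OF der[OF pI]])
    then have "((\<lambda>s. fc (?\<Phi> (p, s *\<^sub>R v))) has_real_derivative ?D p v) (at 0)"
      by (simp add: has_real_derivative_iff_has_vector_derivative o_def)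
    then have "((\<lambda>s. (fc (?\<Phi> (p, s *\<^sub>R v)) - fc p) / s) \<longlongrightarrow> ?D p v) (at 0)"
      by (simp add: has_field_derivative_iff \<Phi>(4))
    then have "((\<lambda>s. (fc (?\<Phi> (p, s *\<^sub>R v)) - fc p) / s) \<longlongrightarrow> ?D p v) (at_right 0)"
      by (rule tendsto_mono[OF at_le, rotated]) simp
    then have "((\<lambda>s. (fc (?\<Phi> (p, s *\<^sub>R v)) - fc p) / s - L / 2 * (s * ?B p v v))
        \<longlongrightarrow> ?D p v - L / 2 * (0 * ?B p v v)) (at_right 0)"
      by (intro tendsto_intros)
    then have ev1: "\<forall>\<^sub>F s in at_right 0. ?D p v - e < (fc (?\<Phi> (p, s *\<^sub>R v)) - fc p) / s - L / 2 * (s * ?B p v v)"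
      using e by (intro order_tendstoD) auto
    have lim: "((\<lambda>s::real. (p, s *\<^sub>R v)) \<longlongrightarrow> (p, 0)) (at_right 0)"
      by (auto intro!: tendsto_eq_intros)
    have ev2: "\<forall>\<^sub>F s in at_right 0. (p, s *\<^sub>R v) \<in> ?W"
      by (rule topological_tendstoD[OF lim \<Phi>(1,2)])
    have "isCont ?\<Phi> (p, 0)"
      using \<Phi>(1-3) continuous_on_eq_continuous_at by blast
    from isCont_tendsto_compose[OF this lim]
    have ev3: "\<forall>\<^sub>F s in at_right 0. ?\<Phi> (p, s *\<^sub>R v) \<in> U"
      using U \<Phi>(4) by (intro topological_tendstoD) auto
    have ev4: "\<forall>\<^sub>F s::real in at_right 0. 0 < s" by (rule eventually_at_right_less)
    from ev1 ev2 ev3 ev4 have "\<forall>\<^sub>F s in at_right 0. ?D p v - e < (fc (?\<Phi> (p, s *\<^sub>R v)) - fc p) / s - L / 2 * (s * ?B p v v)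
        \<and> (p, s *\<^sub>R v) \<in> ?W \<and> ?\<Phi> (p, s *\<^sub>R v) \<in> U \<and> 0 < s"
      by eventually_elim auto
    then obtain s :: real where s: "0 < s" "(p, s *\<^sub>R v) \<in> ?W" "?\<Phi> (p, s *\<^sub>R v) \<in> U"
        "?D p v - e < (fc (?\<Phi> (p, s *\<^sub>R v)) - fc p) / s - L / 2 * (s * ?B p v v)"
      using eventually_happens'[OF trivial_limit_at_right_real] by blast
    have limq: "((\<lambda>q. (q, s *\<^sub>R v)) \<longlongrightarrow> (p, s *\<^sub>R v)) (nhds p)"
      by (intro tendsto_Pair tendsto_const filterlim_ident)
    have "isCont ?\<Phi> (p, s *\<^sub>R v)"
      using \<Phi>(1,3) s(2) continuous_on_eq_continuous_at by blast
    from isCont_tendsto_compose[OF this limq]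
    have lim\<Phi>: "((\<lambda>q. ?\<Phi> (q, s *\<^sub>R v)) \<longlongrightarrow> ?\<Phi> (p, s *\<^sub>R v)) (nhds p)" .
    have cont_fc: "isCont fc q" if "q \<in> chart_image c" for q
      using der[OF that] has_derivative_continuous by blast
    have "((\<lambda>q. fc (?\<Phi> (q, s *\<^sub>R v))) \<longlongrightarrow> fc (?\<Phi> (p, s *\<^sub>R v))) (nhds p)"
      using s(3) by (intro isCont_tendsto_compose[OF cont_fc lim\<Phi>]) (simp add: U_def)
    moreover have "(fc \<longlongrightarrow> fc p) (nhds p)"
      using isCont_tendsto_compose[OF cont_fc[OF pI] filterlim_ident] by simp
    moreover have "((\<lambda>q. ?B q v v) \<longlongrightarrow> ?B p v v) (nhds p)"
      by (rule tendsto_coord_metric[OF M cA(1) pI filterlim_ident])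
    ultimately have "((\<lambda>q. (fc (?\<Phi> (q, s *\<^sub>R v)) - fc q) / s - L / 2 * (s * ?B q v v)) \<longlongrightarrow>
        (fc (?\<Phi> (p, s *\<^sub>R v)) - fc p) / s - L / 2 * (s * ?B p v v)) (nhds p)"
      using s(1) by (intro tendsto_intros) auto
    then have "\<forall>\<^sub>F q in nhds p. ?D p v - e < (fc (?\<Phi> (q, s *\<^sub>R v)) - fc q) / s - L / 2 * (s * ?B q v v)"
      using s(4) by (rule order_tendstoD)
    moreover have "\<forall>\<^sub>F q in nhds p. (q, s *\<^sub>R v) \<in> ?W"
      by (rule topological_tendstoD[OF limq \<Phi>(1) s(2)])
    moreover have "\<forall>\<^sub>F q in nhds p. ?\<Phi> (q, s *\<^sub>R v) \<in> U"
      by (rule topological_tendstoD[OF lim\<Phi> U(1) s(3)])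
    moreover have "\<forall>\<^sub>F q in nhds p. q \<in> U" using U by (rule eventually_nhds_in_open)
    ultimately show ?thesis
    proof eventually_elim
      case (elim q)
      have "(fc (?\<Phi> (q, s *\<^sub>R v)) - fc q) / s \<le> (s * ?D q v + L / 2 * (s * (s * ?B q v v))) / s"
        using upper[OF elim(4,2,3)] s(1) by (intro divide_right_mono) auto
      also have "\<dots> = ?D q v + L / 2 * (s * ?B q v v)" using s(1) by (simp add: field_simps)
      finally show ?case using elim(1) by linarith
    qed
  qed
  have "((\<lambda>q. ?D q v) \<longlongrightarrow> ?D p v) (nhds p)"
  proof (rule tendstoI)
    fix e :: real assume e: "e > 0"
    have "\<forall>\<^sub>F q in nhds p. q \<in> chart_image c" using simps(2) pI by (rule eventually_nhds_in_open)
    with lower[OF e, of v] lower[OF e, of "- v"]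
    show "\<forall>\<^sub>F q in nhds p. dist (?D q v) (?D p v) < e"
    proof eventually_elim
      case (elim q)
      then show ?case
        using linear_neg[OF lin[OF elim(3)], of v] linear_neg[OF lin[OF pI], of v]
        by (simp add: dist_real_def abs_less_iff)
    qed
  qed
  then show ?thesis unfolding isCont_def by (rule tendsto_mono[rotated]) (simp add: at_within_def)
qed

section \<open>Limits of stationary points\<close>

lemma prox_model_in_chart:
  assumes M: "riemannian_manifold A G" and f: "differentiable_on_manifold A f"
    and c: "c \<in> A" and p: "p \<in> chart_image c"
  shows "prox_model A G R f g Lt (chart_inv c p) (tangent_vec A c p u) =
    frechet_derivative (f \<circ> chart_inv c) (at p) u + Lt / 2 * coord_metric A G c p u u
      + g (R (chart_inv c p) (tangent_vec A c p u))"
  by (simp add: prox_model_def inner_grad_coord[OF M f c p] riemannian_metric_at(5)[OF M] coord_metric_def)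

text \<open>The Riemannian metric in the chart is uniformly coercive near \<open>p\<close>. Hence the coordinate
  changes at the iterates are injective, and stationary points whose Riemannian norms tend to \<open>0\<close>
  have coordinates tending to \<open>0\<close>. Each of them supplies a difference quotient of the model that is
  almost nonnegative; removing the linear and the quadratic term leaves a quotient of \<open>g\<close>,
  which is bounded below by a sequence tending to minus the derivative of \<open>f\<close>.\<close>

lemma stationary_point_limit:
  fixes A :: "('m::{t2_space, second_countable_topology}, 'e::euclidean_space) chart set"
  assumes M: "riemannian_manifold A G" and R: "manifold_retraction A R"
    and f: "differentiable_on_manifold A f" and g: "locally_lipschitz A g"
    and c: "c = chart_at A x" and p: "p = snd c x"
    and grad_cont: "\<And>v. isCont (\<lambda>q. frechet_derivative (f \<circ> chart_inv c) (at q) v) p"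
    and X: "X \<longlonglongrightarrow> x"
    and stat: "\<And>n. tangent_stationary_point G (X n) (prox_model A G R f g Lt (X n)) (es n)"
    and es: "(\<lambda>n. rnorm G (X n) (es n)) \<longlonglongrightarrow> 0"
  shows "stationary_point G R (\<lambda>x. f x + g x) x"
proof -
  have A: "smooth_atlas A" using M by (simp add: riemannian_manifold_def)
  have cA: "c \<in> A" "x \<in> fst c" using chart_at_chart[OF A] c by auto
  note simps = chart_simps[OF A cA(1)]
  have pI: "p \<in> chart_image c" and inv: "chart_inv c p = x" using simps cA(2) p by auto
  have Tp: "tangent_vec A c p u = u" for u unfolding p by (rule tangent_vec_chart_at[OF A c])
  note \<Phi> = coord_retraction_at_zero[OF A R c p]
  let ?W = "retraction_dom A R c c" and ?\<Phi> = "coord_retraction A R c"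
  let ?D = "\<lambda>q. frechet_derivative (f \<circ> chart_inv c) (at q)"
  let ?B = "coord_metric A G c" and ?T = "tangent_vec A c"
  let ?l = "\<lambda>n. prox_model A G R f g Lt (X n)"
  define fc where "fc = f \<circ> chart_inv c"
  define gc where "gc = g \<circ> chart_inv c"
  have fc_diff: "(f \<circ> chart_inv c) differentiable (at q)" if "q \<in> chart_image c" for q
    using f cA(1) that by (simp add: differentiable_on_manifold_def)
  have fc_strict: "has_strict_derivative fc (?D p) p"
    unfolding fc_def by (rule has_strict_derivativeI[OF simps(2) pI fc_diff grad_cont])
  obtain r K where r: "r > 0" and gc_lip: "K-lipschitz_on (ball p r) gc"
  proof -
    obtain r0 K where "r0 > 0" and lip: "K-lipschitz_on (ball p r0 \<inter> chart_image c) gc"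
      using g cA(1) pI unfolding locally_lipschitz_def gc_def by meson
    moreover obtain r1 where "r1 > 0" "ball p r1 \<subseteq> chart_image c"
      using simps(2) pI open_contains_ball by blast
    ultimately show ?thesis
      by (intro that[of "min r0 r1" K] lipschitz_on_subset[OF lip]) auto
  qed

  define P where "P n = snd c (X n)" for n
  have "isCont (snd c) x" using simps(1,3) cA(2) continuous_on_eq_continuous_at by blast
  from isCont_tendsto_compose[OF this X] have P: "P \<longlonglongrightarrow> p" by (simp add: P_def[abs_def] p)
  have evX: "\<forall>\<^sub>F n in sequentially. P n \<in> chart_image c \<and> chart_inv c (P n) = X n"
    using topological_tendstoD[OF X simps(1) cA(2)]
    by eventually_elim (simp add: P_def simps(7,8))
  have Blim: "(\<lambda>n. ?B (P n) u v) \<longlonglongrightarrow> ?B p u v" for u v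
    by (rule tendsto_coord_metric[OF M cA(1) pI P])
  have Bbil: "\<forall>\<^sub>F n in sequentially. bilinear (?B (P n))"
    using evX by eventually_elim (simp add: bilinear_coord_metric[OF M cA(1)])
  have Bp: "bilinear (?B p)" by (rule bilinear_coord_metric[OF M cA(1) pI])
  have Bpos: "0 < ?B p u u" if "u \<noteq> 0" for u
    using riemannian_metric_at(3)[OF M that] by (simp add: coord_metric_def Tp)
  obtain m where m: "m > 0" and coercive: "\<forall>\<^sub>F n in sequentially. \<forall>u. m * (norm u)\<^sup>2 \<le> ?B (P n) u u"
    using eventually_coercive[OF Blim Bbil Bp Bpos] by blast

  have "0 \<le> clarke_dd ((\<lambda>x. f x + g x) \<circ> R x) 0 v" for v
    unfolding clarke_dd_nonneg_iff
  proof (intro allI impI)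
    fix e :: real assume e: "e > 0"
    define d where "d n = inverse (real (Suc n))" for n
    have d: "d \<longlonglongrightarrow> 0" unfolding d_def by (rule LIMSEQ_inverse_real_of_nat)
    have "\<forall>\<^sub>F n in sequentially. \<exists>us u t. ?T (P n) us = es n \<and> dist u us < d n \<and> 0 < t \<and> t < d n \<and>
        - d n < (?l n (?T (P n) (u + t *\<^sub>R v)) - ?l n (?T (P n) u)) / t"
      using evX coercive
    proof eventually_elim
      case (elim n)
      have lin: "linear (?T (P n))" using elim by (intro linear_tangent_vec A cA) simp
      have inj: "inj (?T (P n))"
      proof -
        have "u = 0" if "?T (P n) u = 0" for u
        proof -
          have "?B (P n) u u = 0"
            using that by (simp add: coord_metric_def bilinear_lzero[OF riemannian_metric_at(1)[OF M]])
          then have "m * (norm u)\<^sup>2 \<le> 0" using elim by metis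
          then show "u = 0" using m by (simp add: mult_le_0_iff)
        qed
        then show ?thesis using lin linear_injective_0 by blast
      qed
      obtain us where us: "?T (P n) us = es n"
        using linear_injective_imp_surjective[OF lin inj] by (metis dim_UNIV surjD)
      \<comment> \<open>The direction is moved as well: in the tangent space at \<open>X n\<close> it is the vector whose
        coordinates in the fixed chart are \<open>v\<close>.\<close>
      have "0 \<le> clarke_dd (?l n) (?T (P n) us) (?T (P n) v)"
        using stat[of n] bilinear_lzero[OF riemannian_metric_at(1)[OF M]]
        unfolding tangent_stationary_point_def clarke_subdiff_def us by (simp add: zero_ereal_def)
      then have "0 \<le> clarke_dd (\<lambda>u. ?l n (?T (P n) u)) us v"
        by (rule clarke_dd_linear_image[OF lin inj])
      moreover have "d n > 0" by (simp add: d_def)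
      ultimately show ?case using us unfolding clarke_dd_nonneg_iff by blast
    qed
    then obtain us u t where
      ev: "\<forall>\<^sub>F n in sequentially. ?T (P n) (us n) = es n \<and> dist (u n) (us n) < d n \<and> 0 < t n \<and> t n < d n \<and>
        - d n < (?l n (?T (P n) (u n + t n *\<^sub>R v)) - ?l n (?T (P n) (u n))) / t n"
      unfolding eventually_ex by blast
    have us: "us \<longlonglongrightarrow> 0"
    proof (rule Lim_null_comparison)
      show "\<forall>\<^sub>F n in sequentially. norm (us n) \<le> sqrt ((rnorm G (X n) (es n))\<^sup>2 / m)"
        using ev evX coercive
      proof eventually_elim
        case (elim n)
        have "m * (norm (us n))\<^sup>2 \<le> ?B (P n) (us n) (us n)" using elim by blast
        also have "\<dots> = (rnorm G (X n) (es n))\<^sup>2"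
          using elim by (simp add: coord_metric_def riemannian_metric_at(5)[OF M])
        finally show ?case using m by (intro real_le_rsqrt) (simp add: field_simps)
      qed
      have "(\<lambda>n. sqrt ((rnorm G (X n) (es n))\<^sup>2 / m)) \<longlonglongrightarrow> sqrt (0\<^sup>2 / m)"
        using m by (intro tendsto_intros es) auto
      then show "(\<lambda>n. sqrt ((rnorm G (X n) (es n))\<^sup>2 / m)) \<longlonglongrightarrow> 0" by simp
    qed
    have "(\<lambda>n. u n - us n) \<longlonglongrightarrow> 0"
      by (rule Lim_null_comparison[OF _ d]) (use ev in eventually_elim, simp add: dist_norm)
    from tendsto_add[OF this us] have u: "u \<longlonglongrightarrow> 0" by simp
    have t: "t \<longlonglongrightarrow> 0"
      by (rule Lim_null_comparison[OF _ d]) (use ev in eventually_elim, simp)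
    have tpos: "\<forall>\<^sub>F n in sequentially. 0 < t n" using ev by eventually_elim simp
    define \<rho> where "\<rho> n = - d n - ?D (P n) v - Lt * ?B (P n) (u n) v - Lt / 2 * (t n * ?B (P n) v v)" for n
    have "\<rho> \<longlonglongrightarrow> - 0 - ?D p v - Lt * ?B p 0 v - Lt / 2 * (0 * ?B p v v)"
      unfolding \<rho>_def
      by (intro tendsto_intros d t Blim isCont_tendsto_compose[OF grad_cont P]
          tendsto_bilinear_family[OF Blim Bbil Bp u])
    then have \<rho>: "\<rho> \<longlonglongrightarrow> - ?D p v" by (simp add: bilinear_lzero[OF Bp])
    have "(\<lambda>n. u n + t n *\<^sub>R v) \<longlonglongrightarrow> 0 + 0 *\<^sub>R v" by (intro tendsto_intros u t)
    then have utv: "(\<lambda>n. u n + t n *\<^sub>R v) \<longlonglongrightarrow> 0" by simp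
    have quot: "\<forall>\<^sub>F n in sequentially.
        \<rho> n \<le> (gc (?\<Phi> (P n, u n + t n *\<^sub>R v)) - gc (?\<Phi> (P n, u n))) / t n"
      using ev evX topological_tendstoD[OF tendsto_Pair[OF P u] \<Phi>(1,2)]
        topological_tendstoD[OF tendsto_Pair[OF P utv] \<Phi>(1,2)]
    proof eventually_elim
      case (elim n)
      then have Pn: "P n \<in> chart_image c" and Xn: "chart_inv c (P n) = X n" and tn: "0 < t n" by auto
      have bil: "bilinear (?B (P n))" by (rule bilinear_coord_metric[OF M cA(1) Pn])
      have lin: "linear (?D (P n))" using fc_diff[OF Pn] by (rule linear_frechet_derivative)
      have sym: "?B (P n) v (u n) = ?B (P n) (u n) v"
        unfolding coord_metric_def by (rule riemannian_metric_at(2)[OF M])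
      have l: "?l n (?T (P n) w) = ?D (P n) w + Lt / 2 * ?B (P n) w w + gc (?\<Phi> (P n, w))"
        if "(P n, w) \<in> ?W" for w
        using prox_model_in_chart[OF M f cA(1) Pn, of R g Lt w] coord_retraction_inv(3)[OF A cA(1) that]
        by (simp add: Xn gc_def)
      have BB: "?B (P n) (u n + t n *\<^sub>R v) (u n + t n *\<^sub>R v) =
          ?B (P n) (u n) (u n) + 2 * (t n * ?B (P n) (u n) v) + t n * (t n * ?B (P n) v v)"
        using sym by (simp add: bilinear_ladd[OF bil] bilinear_radd[OF bil] bilinear_lmul[OF bil] bilinear_rmul[OF bil] algebra_simps)
      have DD: "?D (P n) (u n + t n *\<^sub>R v) = ?D (P n) (u n) + t n * ?D (P n) v"
        using lin by (simp add: linear_add linear_scale)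
      define \<delta> where "\<delta> = gc (?\<Phi> (P n, u n + t n *\<^sub>R v)) - gc (?\<Phi> (P n, u n))"
      have "- d n < (?l n (?T (P n) (u n + t n *\<^sub>R v)) - ?l n (?T (P n) (u n))) / t n"
        using elim by blast
      also have "\<dots> = (t n * (?D (P n) v + Lt * ?B (P n) (u n) v + Lt / 2 * (t n * ?B (P n) v v)) + \<delta>) / t n"
        unfolding l[OF elim(3)] l[OF elim(4)] BB DD \<delta>_def by (simp add: algebra_simps)
      also have "\<dots> = ?D (P n) v + Lt * ?B (P n) (u n) v + Lt / 2 * (t n * ?B (P n) v v) + \<delta> / t n"
        using tn by (simp add: add_divide_distrib)
      finally show ?case unfolding \<rho>_def \<delta>_def[symmetric] by linarith
    qed
    have "open (Pair p -` ?W)" using \<Phi>(1) by (intro open_vimage continuous_intros)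
    then obtain e1 where e1: "e1 > 0" "ball 0 e1 \<subseteq> Pair p -` ?W"
      using \<Phi>(2) open_contains_ball by blast
    have nv: "1 + norm v > 0" by (simp add: add_pos_nonneg)
    \<comment> \<open>Keeps both \<open>y\<close> and \<open>y + s *\<^sub>R v\<close> in the ball of radius \<open>e1\<close>.\<close>
    define e' where "e' = min e (e1 / (1 + norm v))"
    have e': "e' > 0" using e e1(1) nv by (simp add: e'_def)
    obtain y s where y: "norm y < e'" and s: "0 < s" "s < e'"
      and q: "- e' < ((fc (?\<Phi> (p, y + s *\<^sub>R v)) + gc (?\<Phi> (p, y + s *\<^sub>R v)))
          - (fc (?\<Phi> (p, y)) + gc (?\<Phi> (p, y)))) / s"
      using transport_difference_quotients[OF \<Phi>(5,6,4,1,2,3) fc_strict r gc_lip P u t tpos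
          sequentially_bot \<rho> quot e'] by blast
    have "e' * (1 + norm v) \<le> e1"
      using nv by (simp add: e'_def min_def pos_le_divide_eq split: if_splits)
    moreover have "norm y + norm (s *\<^sub>R v) \<le> norm y + e' * norm v"
      using s by (simp add: mult_right_mono)
    ultimately have "norm y + norm (s *\<^sub>R v) < e1" using y by (simp add: algebra_simps)
    then have "norm (y + s *\<^sub>R v) < e1" "norm y < e1"
      using norm_triangle_ineq[of y "s *\<^sub>R v"] norm_ge_zero[of "s *\<^sub>R v"] by linarith+
    then have yW: "(p, y + s *\<^sub>R v) \<in> ?W" "(p, y) \<in> ?W" using e1(2) by auto
    have "f (R x w) + g (R x w) = fc (?\<Phi> (p, w)) + gc (?\<Phi> (p, w))" if "(p, w) \<in> ?W" for w
      using coord_retraction_inv(3)[OF A cA(1) that] by (simp add: fc_def gc_def inv Tp)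
    with q yW have "- e' < (((\<lambda>x. f x + g x) \<circ> R x) (y + s *\<^sub>R v) - ((\<lambda>x. f x + g x) \<circ> R x) y) / s"
      by simp
    moreover have "e' \<le> e" by (simp add: e'_def)
    ultimately show "\<exists>y t. dist y 0 < e \<and> 0 < t \<and> t < e \<and>
        - e < (((\<lambda>x. f x + g x) \<circ> R x) (y + t *\<^sub>R v) - ((\<lambda>x. f x + g x) \<circ> R x) y) / t"
      using y s by (intro exI[of _ y] exI[of _ s]) auto
  qed
  then show ?thesis
    using bilinear_lzero[OF riemannian_metric_at(1)[OF M]]
    by (simp add: stationary_point_def riem_subdiff_def clarke_subdiff_def zero_ereal_def)
qed

section \<open>Descent and convergence of the method\<close>

lemma differentiable_on_manifold_imp_continuous:
  assumes A: "smooth_atlas A" and f: "differentiable_on_manifold A f"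
  shows "continuous_on UNIV f"
proof -
  have "isCont f x" for x
  proof -
    obtain c where c: "c \<in> A" "x \<in> fst c" using chart_at_chart[OF A] by blast
    note simps = chart_simps[OF A c(1)]
    have "isCont (snd c) x" using simps(1,3) c(2) continuous_on_eq_continuous_at by blast
    moreover have "isCont (f \<circ> chart_inv c) (snd c x)"
      using f c simps(7) differentiable_imp_continuous_within
      unfolding differentiable_on_manifold_def by blast
    ultimately have "isCont ((f \<circ> chart_inv c) \<circ> snd c) x" by (rule continuous_at_compose)
    moreover have "\<forall>\<^sub>F y in nhds x. ((f \<circ> chart_inv c) \<circ> snd c) y = f y"
      using eventually_nhds_in_open[OF simps(1) c(2)] by eventually_elim (simp add: simps(8))
    ultimately show "isCont f x" using isCont_cong by blast
  qed
  then show ?thesis by (simp add: continuous_at_imp_continuous_on)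
qed

text \<open>The parallelogram law applied to \<open>v\<close> and \<open>v - u\<close>; it stands in for the triangle inequality.\<close>

lemma rnorm_le_parallelogram:
  assumes M: "riemannian_manifold A G"
  shows "(rnorm G x u)\<^sup>2 \<le> 2 * (rnorm G x (v - u))\<^sup>2 + 2 * (rnorm G x v)\<^sup>2"
proof -
  have b: "bilinear (G x)" by (rule riemannian_metric_at(1)[OF M])
  \<comment> \<open>\<open>2 *\<^sub>R v - u\<close> is the sum of \<open>v\<close> and \<open>v - u\<close>.\<close>
  have "0 \<le> G x (2 *\<^sub>R v - u) (2 *\<^sub>R v - u)" by (rule riemannian_metric_at(4)[OF M])
  also have "\<dots> = 4 * G x v v - 2 * G x v u - 2 * G x u v + G x u u"
    by (simp add: bilinear_lsub[OF b] bilinear_rsub[OF b] bilinear_lmul[OF b] bilinear_rmul[OF b])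
  also have "\<dots> = 2 * G x (v - u) (v - u) + 2 * G x v v - G x u u"
    by (simp add: bilinear_lsub[OF b] bilinear_rsub[OF b])
  finally show ?thesis by (simp add: riemannian_metric_at(5)[OF M])
qed

lemma irpg_sufficient_decrease:
  assumes M: "riemannian_manifold A G" and R: "manifold_retraction A R"
    and smooth: "retraction_smooth A G R L f N"
    and irpg: "irpg_sequence A G R f g Lt q eps x0 xs eta"
    and N: "xs k \<in> N" "xs (Suc k) \<in> N"
  shows "f (xs (Suc k)) + g (xs (Suc k)) + (Lt - L) / 2 * (rnorm G (xs k) (eta k))\<^sup>2
    \<le> f (xs k) + g (xs k)"
proof -
  let ?x = "xs k" and ?u = "eta k"
  have step: "xs (Suc k) = R ?x ?u"
    and dec: "prox_model A G R f g Lt ?x ?u \<le> prox_model A G R f g Lt ?x 0"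
    using irpg by (auto simp: irpg_sequence_def)
  have "f (R ?x ?u) \<le> f ?x + G ?x (grad A G f ?x) ?u + L / 2 * (rnorm G ?x ?u)\<^sup>2"
    using retraction_smoothD[OF smooth] N step by simp
  moreover have "prox_model A G R f g Lt ?x 0 = g ?x"
    using R bilinear_rzero[OF riemannian_metric_at(1)[OF M]]
    by (simp add: prox_model_def rnorm_def manifold_retraction_def)
  then have "G ?x (grad A G f ?x) ?u + Lt / 2 * (rnorm G ?x ?u)\<^sup>2 + g (R ?x ?u) \<le> g ?x"
    using dec by (simp add: prox_model_def)
  ultimately show ?thesis unfolding step by (simp add: algebra_simps diff_divide_distrib)
qed

text \<open>If the first \<open>n\<close> steps all have \<open>N k > e\<close>, they consume at least \<open>n * \<beta> * e\<^sup>2\<close> of the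
  available decrease \<open>h 0 - l\<close>.\<close>

lemma descent_iteration_count:
  fixes h N :: "nat \<Rightarrow> real"
  assumes desc: "\<And>k. h (Suc k) + \<beta> * (N k)\<^sup>2 \<le> h k" and lb: "\<And>k. l \<le> h k"
    and \<beta>: "\<beta> > 0" and e: "e > 0"
  shows "\<exists>k. real k \<le> (h 0 - l) / (\<beta> * e\<^sup>2) \<and> N k \<le> e"
proof (rule ccontr)
  define C where "C = (h 0 - l) / (\<beta> * e\<^sup>2)"
  assume "\<not> ?thesis"
  then have big: "\<And>k. real k \<le> C \<Longrightarrow> e < N k" by (force simp: C_def)
  have be: "\<beta> * e\<^sup>2 > 0" using \<beta> e by simp
  have C: "0 \<le> C" using lb[of 0] be by (simp add: C_def)
  have sum: "h n + real n * (\<beta> * e\<^sup>2) \<le> h 0" if "\<And>k. k < n \<Longrightarrow> real k \<le> C" for n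
    using that
  proof (induction n)
    case (Suc n)
    have "e\<^sup>2 \<le> (N n)\<^sup>2" using big[OF Suc.prems[of n]] e by (intro power_mono) auto
    then have "\<beta> * e\<^sup>2 \<le> \<beta> * (N n)\<^sup>2" using \<beta> by simp
    moreover have "h n + real n * (\<beta> * e\<^sup>2) \<le> h 0" using Suc by simp
    ultimately show ?case using desc[of n] by (simp add: algebra_simps)
  qed simp
  \<comment> \<open>The indices below \<open>n\<close> are exactly the natural numbers not exceeding \<open>C\<close>.\<close>
  define n where "n = Suc (nat \<lfloor>C\<rfloor>)"
  have small: "real k \<le> C" if "k < n" for k using that C unfolding n_def by linarith
  have "real n * (\<beta> * e\<^sup>2) \<le> h 0 - l" using sum[of n, OF small] lb[of n] by linarith
  then have "real n \<le> C" using be by (simp add: C_def pos_le_divide_eq)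
  moreover have "C < real n" using C unfolding n_def by linarith
  ultimately show False by simp
qed

theorem theorem3p1:
  fixes A :: "('m::{t2_space, second_countable_topology}, 'e::euclidean_space) chart set"
    and G :: "'m \<Rightarrow> 'e \<Rightarrow> 'e \<Rightarrow> real"
    and R :: "'m \<Rightarrow> 'e \<Rightarrow> 'm"
    and f g F :: "'m \<Rightarrow> real"
    and L Lt \<beta> :: real
    and q :: "real \<Rightarrow> real \<Rightarrow> real"
    and eps :: "nat \<Rightarrow> real"
    and x0 :: 'm
    and xs :: "nat \<Rightarrow> 'm"
    and eta :: "nat \<Rightarrow> 'e"
    and \<Omega> :: "'m set"
  assumes manifold: "riemannian_manifold A G"
    and retraction: "manifold_retraction A R"
    and f_diff: "differentiable_on_manifold A f"
    and grad_cont_x0: "grad_continuous_at A f x0"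
    and g_cont: "continuous_on UNIV g"
    and g_lip: "locally_lipschitz A g"
    and F_eq: "F = (\<lambda>x. f x + g x)"
    and F_bdd: "bdd_below (range F)"
    and Omega_eq: "\<Omega> = {x. F x \<le> F x0}"
    and Omega_compact: "compact \<Omega>"
    and f_smooth: "retraction_smooth A G R L f \<Omega>"
    and Lt_pos: "0 < Lt"
    and Lt_gt: "L < Lt"
    and q_cont: "continuous_on UNIV (\<lambda>(s, t). q s t)"
    and irpg: "irpg_sequence A G R f g Lt q eps x0 xs eta"
    and iterates: "\<And>k. xs k \<in> \<Omega>"
    and q_lim: "(\<lambda>k. q (eps k) (rnorm G (xs k) (eta k))) \<longlonglongrightarrow> 0"
    and beta_eq: "\<beta> = (Lt - L) / 2"
  shows "(\<exists>x. accumulation_point xs x) \<and>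
         (\<forall>x. accumulation_point xs x \<longrightarrow>
            stationary_point G R F x \<and>
            (\<forall>\<epsilon>>0. \<exists>k. real k \<le> (F x0 - F x) / (\<beta> * \<epsilon>\<^sup>2) \<and>
               rnorm G (xs k) (eta k) \<le> \<epsilon>))"
proof -
  have A: "smooth_atlas A" using manifold by (simp add: riemannian_manifold_def)
  have \<beta>: "\<beta> > 0" using Lt_gt beta_eq by simp
  let ?N = "\<lambda>k. rnorm G (xs k) (eta k)"
  have desc: "F (xs (Suc k)) + \<beta> * (?N k)\<^sup>2 \<le> F (xs k)" for k
    using irpg_sufficient_decrease[OF manifold retraction f_smooth irpg iterates iterates, of k]
    by (simp add: F_eq beta_eq)
  have x0: "xs 0 = x0" using irpg by (simp add: irpg_sequence_def)
  have F_cont: "continuous_on UNIV F"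
    unfolding F_eq
    by (intro continuous_intros g_cont differentiable_on_manifold_imp_continuous[OF A f_diff])
  have "F (xs (Suc k)) \<le> F (xs k)" for k
    using desc[of k] \<beta> zero_le_power2[of "?N k"] mult_nonneg_nonneg[of \<beta> "(?N k)\<^sup>2"] by linarith
  then have dec: "decseq (\<lambda>k. F (xs k))" by (rule decseq_SucI)
  obtain B where "\<And>y. B \<le> F y" using F_bdd by (auto simp: bdd_below_def)
  then obtain l where l: "(\<lambda>k. F (xs k)) \<longlonglongrightarrow> l" and l_le: "\<And>k. l \<le> F (xs k)"
    using decseq_convergent[OF dec] by metis
  have N2: "(\<lambda>k. (?N k)\<^sup>2) \<longlonglongrightarrow> 0"
  proof (rule Lim_null_comparison)
    show "\<forall>\<^sub>F k in sequentially. norm ((?N k)\<^sup>2) \<le> (F (xs k) - F (xs (Suc k))) / \<beta>"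
    proof (intro always_eventually allI)
      fix k
      have "(?N k)\<^sup>2 * \<beta> \<le> F (xs k) - F (xs (Suc k))"
        using desc[of k] by (simp add: algebra_simps)
      then show "norm ((?N k)\<^sup>2) \<le> (F (xs k) - F (xs (Suc k))) / \<beta>"
        using \<beta> by (simp add: pos_le_divide_eq)
    qed
    have "(\<lambda>k. (F (xs k) - F (xs (Suc k))) / \<beta>) \<longlonglongrightarrow> (l - l) / \<beta>"
      using \<beta> by (intro tendsto_intros l LIMSEQ_Suc) auto
    then show "(\<lambda>k. (F (xs k) - F (xs (Suc k))) / \<beta>) \<longlonglongrightarrow> 0" by simp
  qed

  have "\<exists>es. \<forall>k. tangent_stationary_point G (xs k) (prox_model A G R f g Lt (xs k)) (es k) \<and>
      rnorm G (xs k) (eta k - es k) \<le> q (eps k) (?N k)"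
    using irpg by (intro choice) (simp add: irpg_sequence_def)
  then obtain es where
    es_stat: "\<And>k. tangent_stationary_point G (xs k) (prox_model A G R f g Lt (xs k)) (es k)"
    and es_near: "\<And>k. rnorm G (xs k) (eta k - es k) \<le> q (eps k) (?N k)"
    by blast
  have es: "(\<lambda>k. rnorm G (xs k) (es k)) \<longlonglongrightarrow> 0"
  proof (rule Lim_null_comparison)
    let ?b = "\<lambda>k. sqrt (2 * (q (eps k) (?N k))\<^sup>2 + 2 * (?N k)\<^sup>2)"
    show "\<forall>\<^sub>F k in sequentially. norm (rnorm G (xs k) (es k)) \<le> ?b k"
    proof (intro always_eventually allI)
      fix k
      have "(rnorm G (xs k) (eta k - es k))\<^sup>2 \<le> (q (eps k) (?N k))\<^sup>2"
        using es_near[of k] riemannian_metric_at(6)[OF manifold] by (intro power_mono)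
      then have "(rnorm G (xs k) (es k))\<^sup>2 \<le> 2 * (q (eps k) (?N k))\<^sup>2 + 2 * (?N k)\<^sup>2"
        using rnorm_le_parallelogram[OF manifold, of "xs k" "es k" "eta k"] by linarith
      then show "norm (rnorm G (xs k) (es k)) \<le> ?b k"
        using riemannian_metric_at(6)[OF manifold] by (simp add: real_le_rsqrt)
    qed
    have "?b \<longlonglongrightarrow> sqrt (2 * 0\<^sup>2 + 2 * 0)" by (intro tendsto_intros q_lim N2)
    then show "?b \<longlonglongrightarrow> 0" by simp
  qed

  have limit: "stationary_point G R F x \<and>
      (\<forall>\<epsilon>>0. \<exists>k. real k \<le> (F x0 - F x) / (\<beta> * \<epsilon>\<^sup>2) \<and> ?N k \<le> \<epsilon>)"
    if acc: "accumulation_point xs x" for x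
  proof
    obtain r where r: "strict_mono r" and X: "(xs \<circ> r) \<longlonglongrightarrow> x"
      using acc by (auto simp: accumulation_point_def)
    have "isCont F x" using F_cont by (simp add: continuous_on_eq_continuous_at)
    from isCont_tendsto_compose[OF this X] have "((\<lambda>k. F (xs k)) \<circ> r) \<longlonglongrightarrow> F x"
      by (simp add: o_def)
    with LIMSEQ_subseq_LIMSEQ[OF l r] have "l = F x" by (rule LIMSEQ_unique)
    then have F_le: "F x \<le> F (xs k)" for k using l_le by simp
    show "\<forall>\<epsilon>>0. \<exists>k. real k \<le> (F x0 - F x) / (\<beta> * \<epsilon>\<^sup>2) \<and> ?N k \<le> \<epsilon>"
      using descent_iteration_count[where h = "\<lambda>k. F (xs k)" and N = ?N, OF desc F_le \<beta>] x0 by simp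
    define c where "c = chart_at A x"
    define p where "p = snd c x"
    have "isCont (\<lambda>q. frechet_derivative (f \<circ> chart_inv c) (at q) v) p" for v
    proof (cases "F x < F x0")
      case True
      have "open (F -` {..<F x0})" using F_cont by (intro open_vimage) auto
      moreover have "F -` {..<F x0} \<subseteq> \<Omega>" by (auto simp: Omega_eq)
      ultimately have "x \<in> interior \<Omega>" using True by (intro interiorI[of "F -` {..<F x0}"]) auto
      then show ?thesis
        by (rule grad_coord_continuous[OF manifold retraction f_diff f_smooth _ c_def p_def])
    next
      case False
      have const: "F (xs k) = F x0" for k
        using False F_le[of k] iterates[of k] by (simp add: Omega_eq)
      have eta0: "eta k = 0" for k
      proof (rule ccontr)
        assume "eta k \<noteq> 0"
        then have "0 < (?N k)\<^sup>2"
          using riemannian_metric_at(3,5)[OF manifold] by simp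
        then have "0 < \<beta> * (?N k)\<^sup>2" using \<beta> by simp
        then show False using desc[of k] const[of k] const[of "Suc k"] by linarith
      qed
      have "xs k = x0" for k
      proof (induction k)
        case (Suc k)
        then show ?case using irpg retraction eta0[of k]
          by (simp add: irpg_sequence_def manifold_retraction_def)
      qed (rule x0)
      then have "(\<lambda>k. x0) \<longlonglongrightarrow> x" using X by (simp add: o_def)
      then have "x = x0" using LIMSEQ_unique[OF tendsto_const] by metis
      then show ?thesis
        using grad_cont_x0 chart_at_chart[OF A, of x0] by (simp add: grad_continuous_at_def c_def p_def)
    qed
    from stationary_point_limit[OF manifold retraction f_diff g_lip c_def p_def this X, of Lt "es \<circ> r"]
    show "stationary_point G R F x"
      using es_stat LIMSEQ_subseq_LIMSEQ[OF es r] by (simp add: F_eq o_def)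
  qed

  have "\<exists>x. accumulation_point xs x"
    using compact_imp_seq_compact[OF Omega_compact] iterates
    unfolding seq_compact_def accumulation_point_def by meson
  with limit show ?thesis by blast
qed

end
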